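(* (Local uncertainty inequalities for the MFrFT) (i) If $0<\theta<\frac N2$, there exists a constant $A_\theta$ such that for every measurable subset $K$ of $\mathbb{R}^N$ and all $f\in L^2(\mathbb{R}^N)$ $$\int_K|(\mathfrak F_{\boldsymbol\alpha,\lambda}f)(\boldsymbol\eta)|^2\,d\boldsymbol\eta\ \le\ |c(\boldsymbol\alpha_\lambda)|^2A_\theta\frac{|\sin\boldsymbol\alpha|_m}{(\lambda^2)^N}\,|K|^{\frac{2\theta}{N}}\ \big\|\,\|\boldsymbol x\|^\theta f\,\big\|^2_{L^2(\mathbb{R}^N)}.$$ (ii) If $\theta>\frac N2$, there exists a constant $A_\theta$ such that for every measurable subset $K$ of $\mathbb{R}^N$ and all $f\in L^2(\mathbb{R}^N)$ $$\int_K|(\mathfrak F_{\boldsymbol\alpha,\lambda}f)(\boldsymbol\eta)|^2\,d\boldsymbol\eta\ \le\ |c(\boldsymbol\alpha_\lambda)|^2A_\theta\frac{|\sin\boldsymbol\alpha|_m}{(\lambda^2)^N}\,|K|\ \|f\|^{2-\frac N\theta}_{L^2(\mathbb{R}^N)}\ \big\|\,\|\boldsymbol x\|^\theta f\,\big\|^{\frac N\theta}_{L^2(\mathbb{R}^N)}.$$ Here $|K|$ denotes the Lebesgue measure of $K$.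
   Context: $N\ge1$ is an integer, $\lambda\in\mathbb{R}\setminus\{0\}$, $\boldsymbol\alpha=(\alpha_1,\dots,\alpha_N)$ with $\alpha_k\in(-\pi,\pi)\setminus\{0\}$, all fixed. $\|\boldsymbol x\|$ is the Euclidean norm on $\mathbb{R}^N$ and $\|\boldsymbol x\|^\theta f$ denotes the function $\boldsymbol x\mapsto\|\boldsymbol x\|^\theta f(\boldsymbol x)$; $|\sin\boldsymbol\alpha|_m=|\sin\alpha_1\sin\alpha_2\cdots\sin\alpha_N|$. Put $a(\alpha_k)=\tfrac12\cot\alpha_k$, $c(\alpha_k)=\sqrt{1-i\cot\alpha_k}$, $c(\boldsymbol\alpha_\lambda)=c(\alpha_1)\cdots c(\alpha_N)$, $e_{\boldsymbol\alpha,\lambda^2}(\boldsymbol x)=e^{i\lambda^2\sum_{k=1}^N a(\alpha_k)x_k^2}$. The multidimensional fractional Fourier transform (MFrFT) is $(\mathfrak F_{\boldsymbol\alpha,\lambda}f)(\boldsymbol\xi)=\int_{\mathbb{R}^N}f(\boldsymbol x)K_{\boldsymbol\alpha,\lambda}(\boldsymbol x,\boldsymbol\xi)\,d\boldsymbol x$ (extended to $L^2(\mathbb{R}^N)$ as usual), with kernel $K_{\boldsymbol\alpha,\lambda}(\boldsymbol x,\boldsymbol\xi)=\frac{c(\boldsymbol\alpha_\lambda)}{(\sqrt{2\pi})^N}e_{\boldsymbol\alpha,\lambda^2}(\boldsymbol x)e_{\boldsymbol\alpha,\lambda^2}(\boldsymbol\xi)e^{-i\lambda^2\sum_{k=1}^N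 x_k\xi_k\csc\alpha_k}$. *)

theory Defs
  imports "HOL-Analysis.Analysis"
begin

definition mfrft_a :: "real \<Rightarrow> real" where
  "mfrft_a t = cot t / 2"

definition mfrft_c :: "real \<Rightarrow> complex" where
  "mfrft_c t = csqrt (1 - \<i> * complex_of_real (cot t))"

definition mfrft_C :: "real ^ 'n \<Rightarrow> complex" where
  "mfrft_C \<alpha> = (\<Prod>k\<in>UNIV. mfrft_c (\<alpha> $ k))"

definition abs_sin_prod :: "real ^ 'n \<Rightarrow> real" where
  "abs_sin_prod \<alpha> = \<bar>\<Prod>k\<in>UNIV. sin (\<alpha> $ k)\<bar>"

definition chirp :: "real ^ 'n \<Rightarrow> real \<Rightarrow> real ^ 'n \<Rightarrow> complex" where
  "chirp \<alpha> lam x = exp (\<i> * complex_of_real (lam\<^sup>2 * (\<Sum>k\<in>UNIV. mfrft_a (\<alpha> $ k) * (x $ k)\<^sup>2)))"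

definition mfrft_kernel :: "real ^ 'n \<Rightarrow> real \<Rightarrow> real ^ 'n \<Rightarrow> real ^ 'n \<Rightarrow> complex" where
  "mfrft_kernel \<alpha> lam x \<xi> =
     mfrft_C \<alpha> / complex_of_real (sqrt (2 * pi) ^ CARD('n)) * chirp \<alpha> lam x * chirp \<alpha> lam \<xi> *
     exp (- \<i> * complex_of_real (lam\<^sup>2 * (\<Sum>k\<in>UNIV. x $ k * \<xi> $ k * (1 / sin (\<alpha> $ k)))))"

definition mfrft_L1 :: "real ^ 'n \<Rightarrow> real \<Rightarrow> (real ^ 'n \<Rightarrow> complex) \<Rightarrow> real ^ 'n \<Rightarrow> complex" where
  "mfrft_L1 \<alpha> lam f \<xi> = (LINT x|lebesgue. f x * mfrft_kernel \<alpha> lam x \<xi>)"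

(* Extended nonnegative power; only meaningful for exponents p > 0. *)
definition epowr :: "ennreal \<Rightarrow> real \<Rightarrow> ennreal" where
  "epowr a p = (if a = \<infinity> then \<infinity> else ennreal (enn2real a powr p))"

(* May be infinite, so that it also applies to weighted functions lying outside L2. *)
definition L2_enorm :: "('a::euclidean_space \<Rightarrow> complex) \<Rightarrow> ennreal" where
  "L2_enorm f = epowr (\<integral>\<^sup>+x. ennreal ((cmod (f x))\<^sup>2) \<partial>lebesgue) (1 / 2)"

definition L2_space :: "('a::euclidean_space \<Rightarrow> complex) set" where
  "L2_space = {f \<in> borel_measurable lebesgue. L2_enorm f < \<infinity>}"

(* g represents the value at f of the continuous extension of mfrft_L1 from L1 \<inter> L2 to L2;
   since L1 \<inter> L2 is dense in L2, such a g is unique up to null sets. *)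
definition is_mfrft_extension ::
  "real ^ 'n \<Rightarrow> real \<Rightarrow> (real ^ 'n \<Rightarrow> complex) \<Rightarrow> (real ^ 'n \<Rightarrow> complex) \<Rightarrow> bool" where
  "is_mfrft_extension \<alpha> lam f g \<longleftrightarrow>
     g \<in> L2_space \<and>
     (\<forall>h :: nat \<Rightarrow> real ^ 'n \<Rightarrow> complex.
        (\<forall>n. integrable lebesgue (h n) \<and> h n \<in> L2_space) \<longrightarrow>
        (\<lambda>n. L2_enorm (\<lambda>x. h n x - f x)) \<longlonglongrightarrow> 0 \<longrightarrow>
        (\<lambda>n. L2_enorm (\<lambda>\<xi>. mfrft_L1 \<alpha> lam (h n) \<xi> - g \<xi>)) \<longlonglongrightarrow> 0)"

definition mfrft :: "real ^ 'n \<Rightarrow> real \<Rightarrow> (real ^ 'n \<Rightarrow> complex) \<Rightarrow> real ^ 'n \<Rightarrow> complex" where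
  "mfrft \<alpha> lam f = (SOME g. is_mfrft_extension \<alpha> lam f g)"

definition norm_weight :: "real \<Rightarrow> ('a::euclidean_space \<Rightarrow> complex) \<Rightarrow> 'a \<Rightarrow> complex" where
  "norm_weight \<theta> f x = complex_of_real (norm x powr \<theta>) * f x"

end

theory Submission
  imports Defs "HOL-Probability.Characteristic_Functions"
begin

text \<open>Up to chirps of modulus one, the transform is a Fourier transform with rescaled frequencies.
  Two of its properties suffice: the transform of an integrable function is bounded by a multiple of its
  \<open>L\<^sup>1\<close> norm (\<open>norm_mfrft_L1\<close>), and its \<open>L\<^sup>2\<close> norm is bounded by a multiple of that of the
  function (\<open>mfrft_L1_square_integral_bound\<close>). The second is half of Plancherel's theorem; it is
  proved by inserting a Gaussian weight, whose Fourier transform is again a positive Gaussian of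
  mass independent of the width, and letting the weight tend to \<open>1\<close>
  (\<open>gaussian_weighted_Fourier_bound\<close>, \<open>Fourier_square_integral_bound\<close>).

  Together with the completeness of \<open>L\<^sup>2\<close> (\<open>geometric_Cauchy_L2_limit\<close>) the second property also
  shows that the continuous extension to \<open>L\<^sup>2\<close> exists and that the transform of \<open>f\<close> is
  close to the integral transform of every integrable \<open>p\<close> which is close to \<open>f\<close>
  (\<open>mfrft_approximation\<close>).

  The inequalities then follow by splitting \<open>f\<close> at a sphere of radius \<open>r\<close> and bounding the pieces
  by the weighted norm with the Cauchy-Schwarz inequality. If \<open>\<theta> < N / 2\<close>, the inner piece is
  integrable and has a bounded transform, while the outer piece is small in \<open>L\<^sup>2\<close>; the best radius
  satisfies \<open>r ^ N = 1 / |K|\<close>. If \<open>\<theta> > N / 2\<close>, both pieces are integrable, and the best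
  radius balances the weighted norm against the unweighted one. In both cases the integrals of powers of
  the norm are estimated over dyadic annuli (\<open>nn_integral_norm_powr_cball\<close>,
  \<open>nn_integral_norm_powr_outside\<close>).\<close>

section \<open>Fourier transforms of Gaussians\<close>

text \<open>A rescaling of the characteristic function of the standard normal distribution.\<close>

lemma gaussian_fourier_real:
  fixes e z :: real
  assumes "0 < e"
  shows "integrable lborel (\<lambda>s. complex_of_real (exp (- (e * s)\<^sup>2 / 2)) * cis (z * s))" (is "integrable _ ?f")
    and "(LINT s|lborel. complex_of_real (exp (- (e * s)\<^sup>2 / 2)) * cis (z * s))
           = complex_of_real (sqrt (2 * pi) / e * exp (- (z / e)\<^sup>2 / 2))"
proof -
  let ?g = "\<lambda>s. complex_of_real (exp (- s\<^sup>2 / 2)) * cis (z / e * s)"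
  have scale: "?f = (\<lambda>s. ?g (0 + e * s))"
    using assms by (simp add: fun_eq_iff)
  have g: "?g = (\<lambda>s. sqrt (2 * pi) *\<^sub>R (std_normal_density s *\<^sub>R iexp (z / e * s)))"
    by (auto simp: fun_eq_iff std_normal_density_def cis_conv_exp scaleR_conv_of_real field_simps)
  have "(LINT s|lborel. std_normal_density s *\<^sub>R iexp (z / e * s))
      = char std_normal_distribution (z / e)"
    unfolding char_def by (subst integral_density) auto
  hence ig: "(LINT s|lborel. ?g s) = complex_of_real (sqrt (2 * pi) * exp (- (z / e)\<^sup>2 / 2))"
    unfolding g by (simp add: char_std_normal_distribution scaleR_conv_of_real)
  have nn: "integrable lborel std_normal_density"
    by simp
  have intg: "integrable lborel ?g"
    unfolding g by (intro integrable_scaleR_right, rule Bochner_Integration.integrable_bound[OF nn]) auto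
  show "integrable lborel ?f"
    unfolding scale using intg assms by (intro lborel_integrable_real_affine) auto
  have "(LINT s|lborel. ?g s) = \<bar>e\<bar> *\<^sub>R (LINT s|lborel. ?g (0 + e * s))"
    using assms by (intro lborel_integral_real_affine) auto
  thus "(LINT s|lborel. ?f s) = complex_of_real (sqrt (2 * pi) / e * exp (- (z / e)\<^sup>2 / 2))"
    unfolding scale[symmetric] ig using assms by (simp add: field_simps scaleR_conv_of_real)
qed

lemma gaussian_nn_integral_real:
  fixes c :: real
  assumes "c \<noteq> 0"
  shows "(\<integral>\<^sup>+s. ennreal (exp (- (c * s)\<^sup>2 / 2)) \<partial>lborel) = ennreal (sqrt (2 * pi) / \<bar>c\<bar>)"
proof -
  have "integrable lborel (\<lambda>s. complex_of_real (exp (- (\<bar>c\<bar> * s)\<^sup>2 / 2)))"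
    and "(LINT s|lborel. complex_of_real (exp (- (\<bar>c\<bar> * s)\<^sup>2 / 2))) = complex_of_real (sqrt (2 * pi) / \<bar>c\<bar>)"
    using gaussian_fourier_real[of "\<bar>c\<bar>" 0] assms by auto
  hence "integrable lborel (\<lambda>s. exp (- (c * s)\<^sup>2 / 2))"
    and "(LINT s|lborel. exp (- (c * s)\<^sup>2 / 2)) = sqrt (2 * pi) / \<bar>c\<bar>"
    by (auto simp: power_mult_distrib complex_of_real_integrable_eq simp flip: of_real_divide)
  thus ?thesis
    by (subst nn_integral_eq_integral) auto
qed

lemma lborel_prod_integral:
  fixes f :: "'a::euclidean_space \<Rightarrow> real \<Rightarrow> complex"
  assumes f: "\<And>b. b \<in> Basis \<Longrightarrow> integrable lborel (f b)"
  shows "integrable lborel (\<lambda>x::'a. \<Prod>b\<in>Basis. f b (x \<bullet> b))"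
    and "(LINT x|lborel. (\<Prod>b\<in>Basis. f b (x \<bullet> b))) = (\<Prod>b\<in>Basis. (LINT s|lborel. f b s))"
proof -
  interpret product_sigma_finite "\<lambda>_::'a. lborel :: real measure"
    by (simp add: lborel.sigma_finite_measure_axioms product_sigma_finite_def)
  have [measurable]: "f b \<in> borel_measurable borel" if "b \<in> Basis" for b
    using f[OF that] by auto
  have m: "(\<lambda>x::'a. \<Prod>b\<in>Basis. f b (x \<bullet> b)) \<in> borel_measurable borel"
    by measurable
  have t: "(\<lambda>f. \<Sum>b\<in>Basis. f b *\<^sub>R b) \<in> measurable (\<Pi>\<^sub>M b\<in>(Basis::'a set). lborel) (borel::'a measure)"
    by measurable
  have eq: "(\<Prod>b\<in>Basis. f b ((\<Sum>b'\<in>Basis. y b' *\<^sub>R b') \<bullet> b)) = (\<Prod>b\<in>Basis. f b (y b))" for y :: "'a \<Rightarrow> real"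
    by (rule prod.cong) auto
  show "integrable lborel (\<lambda>x::'a. \<Prod>b\<in>Basis. f b (x \<bullet> b))"
    unfolding lborel_eq[where 'a='a] integrable_distr_eq[OF t m] eq
    by (rule product_integrable_prod) (auto intro: f)
  show "(LINT x|lborel. (\<Prod>b\<in>Basis. f b (x \<bullet> b))) = (\<Prod>b\<in>Basis. (LINT s|lborel. f b s))"
    unfolding lborel_eq[where 'a='a] integral_distr[OF t m] eq
    by (rule product_integral_prod) (auto intro: f)
qed

text \<open>The phase of the transform is a diagonal bilinear form, here written as the inner product
  of \<open>dilate u x\<close> with the frequency. Carrying the diagonal through the argument saves the
  change of variables that would reduce it to the identity.\<close>

definition dilate :: "'a::euclidean_space \<Rightarrow> 'a \<Rightarrow> 'a" where
  "dilate u x = (\<Sum>b\<in>Basis. ((u \<bullet> b) * (x \<bullet> b)) *\<^sub>R b)"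

lemma dilate_inner_Basis [simp]: "b \<in> Basis \<Longrightarrow> dilate u x \<bullet> b = (u \<bullet> b) * (x \<bullet> b)"
  by (simp add: dilate_def)

lemma dilate_diff: "dilate u (x - y) = dilate u x - dilate u y"
  by (rule euclidean_eqI) (simp add: inner_diff_left algebra_simps)

lemma dilate_measurable [measurable]: "dilate u \<in> borel_measurable borel"
  unfolding dilate_def by measurable

lemma exp_norm_square_prod:
  fixes x :: "'a::euclidean_space"
  shows "exp (- (norm x)\<^sup>2 / 2) = (\<Prod>b\<in>Basis. exp (- (x \<bullet> b)\<^sup>2 / 2))"
proof -
  have "(norm x)\<^sup>2 = (\<Sum>b\<in>Basis. (x \<bullet> b)\<^sup>2)"
    unfolding power2_norm_eq_inner by (subst euclidean_inner) (simp add: power2_eq_square)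
  thus ?thesis
    by (simp add: exp_sum[symmetric] sum_negf sum_divide_distrib)
qed

lemma cis_sum: "finite A \<Longrightarrow> cis (\<Sum>a\<in>A. f a) = (\<Prod>a\<in>A. cis (f a))"
  by (induction A rule: finite_induct) (auto simp flip: cis_mult)

lemma gaussian_fourier:
  fixes z :: "'a::euclidean_space"
  assumes "0 < e"
  shows "integrable lborel (\<lambda>\<xi>. complex_of_real (exp (- (norm (e *\<^sub>R \<xi>))\<^sup>2 / 2)) * cis (z \<bullet> \<xi>))"
    and "(LINT \<xi>|lborel. complex_of_real (exp (- (norm (e *\<^sub>R \<xi>))\<^sup>2 / 2)) * cis (z \<bullet> \<xi>))
           = complex_of_real ((sqrt (2 * pi) / e) ^ DIM('a) * exp (- (norm (z /\<^sub>R e))\<^sup>2 / 2))"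
proof -
  have eq: "complex_of_real (exp (- (norm (e *\<^sub>R \<xi>))\<^sup>2 / 2)) * cis (z \<bullet> \<xi>)
     = (\<Prod>b\<in>Basis. complex_of_real (exp (- (e * (\<xi> \<bullet> b))\<^sup>2 / 2)) * cis ((z \<bullet> b) * (\<xi> \<bullet> b)))" for \<xi> :: 'a
    unfolding exp_norm_square_prod euclidean_inner[of z \<xi>] prod.distrib
    by (simp add: cis_sum)
  note g = gaussian_fourier_real[OF assms]
  show "integrable lborel (\<lambda>\<xi>. complex_of_real (exp (- (norm (e *\<^sub>R \<xi>))\<^sup>2 / 2)) * cis (z \<bullet> \<xi>))"
    unfolding eq by (rule lborel_prod_integral) (rule g)
  have e: "exp (- (norm (z /\<^sub>R e))\<^sup>2 / 2) = (\<Prod>b\<in>Basis. exp (- ((z \<bullet> b) / e)\<^sup>2 / 2))"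
    unfolding exp_norm_square_prod by (simp add: field_simps)
  show "(LINT \<xi>|lborel. complex_of_real (exp (- (norm (e *\<^sub>R \<xi>))\<^sup>2 / 2)) * cis (z \<bullet> \<xi>))
           = complex_of_real ((sqrt (2 * pi) / e) ^ DIM('a) * exp (- (norm (z /\<^sub>R e))\<^sup>2 / 2))"
    unfolding eq e
    by (subst lborel_prod_integral(2), rule g(1), subst g(2)) (simp add: prod.distrib prod_dividef power_divide)
qed

text \<open>The Fourier transforms of the Gaussian weights are an approximate identity: their mass does
  not depend on the width \<open>e\<close>. This is what makes the Plancherel bound uniform in \<open>e\<close>.\<close>

lemma gaussian_nn_integral_dilate:
  fixes u :: "'a::euclidean_space"
  assumes "0 < e" and u: "\<And>b. b \<in> Basis \<Longrightarrow> u \<bullet> b \<noteq> 0"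
  shows "(\<integral>\<^sup>+x. ennreal ((sqrt (2 * pi) / e) ^ DIM('a) * exp (- (norm (dilate u x /\<^sub>R e))\<^sup>2 / 2)) \<partial>lborel)
       = ennreal (\<Prod>b\<in>Basis. 2 * pi / \<bar>u \<bullet> b\<bar>)"
proof -
  have "(\<integral>\<^sup>+x. ennreal ((sqrt (2 * pi) / e) ^ DIM('a) * exp (- (norm (dilate u x /\<^sub>R e))\<^sup>2 / 2)) \<partial>lborel)
      = (\<integral>\<^sup>+x. (\<Prod>b\<in>Basis. ennreal (sqrt (2 * pi) / e) * ennreal (exp (- ((u \<bullet> b) / e * (x \<bullet> b))\<^sup>2 / 2))) \<partial>lborel)"
    unfolding exp_norm_square_prod using assms(1)
    by (intro nn_integral_cong) (auto simp: prod_ennreal prod.distrib prod_dividef field_simps ennreal_mult'[symmetric])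
  also have "\<dots> = (\<Prod>b\<in>Basis. \<integral>\<^sup>+s. ennreal (sqrt (2 * pi) / e) * ennreal (exp (- ((u \<bullet> b) / e * s)\<^sup>2 / 2)) \<partial>lborel)"
    by (rule nn_integral_lborel_prod) auto
  also have "\<dots> = (\<Prod>b\<in>Basis. ennreal (2 * pi / \<bar>u \<bullet> b\<bar>))"
  proof (rule prod.cong[OF refl])
    fix b :: 'a assume b: "b \<in> Basis"
    show "(\<integral>\<^sup>+s. ennreal (sqrt (2 * pi) / e) * ennreal (exp (- ((u \<bullet> b) / e * s)\<^sup>2 / 2)) \<partial>lborel)
        = ennreal (2 * pi / \<bar>u \<bullet> b\<bar>)"
      using assms(1) u[OF b]
      by (subst nn_integral_cmult, measurable, subst gaussian_nn_integral_real)
         (auto simp: ennreal_mult'[symmetric])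
  qed
  finally show ?thesis
    by (simp add: prod_ennreal)
qed

section \<open>A Plancherel inequality\<close>

lemma lborel_integrable_product_bound:
  fixes f :: "'a::euclidean_space \<times> 'b::euclidean_space \<Rightarrow> complex"
    and A :: "'a \<Rightarrow> real" and B :: "'b \<Rightarrow> real"
  assumes [measurable]: "f \<in> borel_measurable (lborel \<Otimes>\<^sub>M lborel)"
    and A: "integrable lborel A" and B: "integrable lborel B"
    and bd: "\<And>x y. cmod (f (x, y)) \<le> A x * B y"
  shows "integrable (lborel \<Otimes>\<^sub>M lborel) f"
proof (rule lborel_pair.Fubini_integrable)
  note [measurable] = borel_measurable_integrable[OF A] borel_measurable_integrable[OF B]
  have s: "integrable lborel (\<lambda>y. f (x, y))" for x
    by (rule Bochner_Integration.integrable_bound[of _ "\<lambda>y. A x * B y"])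
       (auto intro!: B bd[THEN order_trans] simp: measurable_compose[OF _ assms(1)])
  show "AE x in lborel. integrable lborel (\<lambda>y. f (x, y))"
    using s by simp
  have b: "(LINT y|lborel. cmod (f (x, y))) \<le> A x * (LINT y|lborel. B y)" for x
  proof -
    have "(LINT y|lborel. cmod (f (x, y))) \<le> (LINT y|lborel. A x * B y)"
      by (rule integral_mono) (auto intro: s B bd)
    thus ?thesis by simp
  qed
  show "integrable lborel (\<lambda>x. LINT y|lborel. cmod (f (x, y)))"
    by (rule Bochner_Integration.integrable_bound[of _ "\<lambda>x. A x * (LINT y|lborel. B y)"])
       (auto intro!: A order_trans[OF b])
qed fact

lemma borel_measurable_cis [measurable (raw)]:
  "f \<in> borel_measurable M \<Longrightarrow> (\<lambda>x. cis (f x)) \<in> borel_measurable M"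
  unfolding cis_conv_exp by measurable

lemma borel_measurable_cnj [measurable (raw)]:
  "f \<in> borel_measurable M \<Longrightarrow> (\<lambda>x. cnj (f x)) \<in> borel_measurable M"
  by (rule borel_measurable_continuous_on[of cnj]) (auto intro: continuous_intros)

lemma norm_integral_le_nn_integral:
  fixes f :: "'a \<Rightarrow> 'b::{banach, second_countable_topology}"
  shows "ennreal (norm (integral\<^sup>L M f)) \<le> (\<integral>\<^sup>+x. ennreal (norm (f x)) \<partial>M)"
  by (cases "integrable M f") (auto simp: integral_norm_bound_ennreal not_integrable_integral_eq)

text \<open>With a Gaussian weight all integrals converge absolutely. Writing the square as
  \<open>F * cnj F\<close> and exchanging integrals turns the left side into
  \<open>\<integral>\<integral> cnj (g y) g x G (y - x) dx dy\<close>, where \<open>G\<close> is the Fourier transform of the weight. Since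
  \<open>G\<close> is even and nonnegative, \<open>2 |g x| |g y| \<le> |g x|\<^sup>2 + |g y|\<^sup>2\<close> bounds this by the mass of \<open>G\<close>
  times the square integral of \<open>g\<close> (Schur's test).\<close>

lemma gaussian_weighted_Fourier_bound:
  fixes g :: "'a::euclidean_space \<Rightarrow> complex" and u :: 'a
  assumes g: "integrable lborel g"
    and e: "0 < e" and u: "\<And>b. b \<in> Basis \<Longrightarrow> u \<bullet> b \<noteq> 0"
  defines "F \<equiv> (\<lambda>\<xi>. LINT x|lborel. g x * cis (- (dilate u x \<bullet> \<xi>)))"
  shows "(\<integral>\<^sup>+\<xi>. ennreal (exp (- (norm (e *\<^sub>R \<xi>))\<^sup>2 / 2) * (cmod (F \<xi>))\<^sup>2) \<partial>lborel)
       \<le> ennreal (\<Prod>b\<in>Basis. 2 * pi / \<bar>u \<bullet> b\<bar>) * (\<integral>\<^sup>+x. ennreal ((cmod (g x))\<^sup>2) \<partial>lborel)"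
proof -
  note [measurable] = borel_measurable_integrable[OF g]
  define w where "w = (\<lambda>\<xi>::'a. exp (- (norm (e *\<^sub>R \<xi>))\<^sup>2 / 2))"
  define G where "G = (\<lambda>z::'a. (sqrt (2 * pi) / e) ^ DIM('a) * exp (- (norm (dilate u z /\<^sub>R e))\<^sup>2 / 2))"
  define P where "P = (\<Prod>b\<in>Basis. 2 * pi / \<bar>u \<bullet> b\<bar>)"
  define I where "I = (LINT x|lborel. cmod (g x))"
  have w0: "w \<xi> \<ge> 0" and G0: "G z \<ge> 0" for \<xi> z
    using e by (auto simp: w_def G_def)
  have [measurable]: "w \<in> borel_measurable borel" "G \<in> borel_measurable borel"
    unfolding w_def G_def by measurable
  have [measurable]: "F \<in> borel_measurable borel"
    unfolding F_def by measurable
  have wint: "integrable lborel w"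
    using gaussian_fourier(1)[OF e, where z="0::'a"] complex_of_real_integrable_eq[of lborel w]
    by (simp add: w_def)
  have FI: "cmod (F \<xi>) \<le> I" for \<xi>
    unfolding F_def I_def by (rule order_trans[OF integral_norm_bound]) (simp add: norm_mult)
  have I0: "I \<ge> 0" by (simp add: I_def)

  have WG: "(LINT \<xi>|lborel. complex_of_real (w \<xi>) * cis (dilate u z \<bullet> \<xi>)) = complex_of_real (G z)" for z
    using gaussian_fourier(2)[OF e, where z="dilate u z"] by (simp add: w_def G_def)
  have inner: "(LINT \<xi>|lborel. complex_of_real (w \<xi>) * cis (dilate u y \<bullet> \<xi>) * F \<xi>)
      = (LINT x|lborel. g x * complex_of_real (G (y - x)))" for y
  proof -
    have "(LINT \<xi>|lborel. complex_of_real (w \<xi>) * cis (dilate u y \<bullet> \<xi>) * F \<xi>)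
       = (LINT \<xi>|lborel. LINT x|lborel. complex_of_real (w \<xi>) * cis (dilate u y \<bullet> \<xi>) * (g x * cis (- (dilate u x \<bullet> \<xi>))))"
      unfolding F_def by simp
    also have "\<dots> = (LINT x|lborel. LINT \<xi>|lborel. complex_of_real (w \<xi>) * cis (dilate u y \<bullet> \<xi>) * (g x * cis (- (dilate u x \<bullet> \<xi>))))"
    proof (rule lborel_pair.Fubini_integral)
      show "integrable (lborel \<Otimes>\<^sub>M lborel) (\<lambda>(x, \<xi>). complex_of_real (w \<xi>) * cis (dilate u y \<bullet> \<xi>) * (g x * cis (- (dilate u x \<bullet> \<xi>))))"
        by (rule lborel_integrable_product_bound[where A="\<lambda>x. cmod (g x)" and B=w])
           (auto simp: norm_mult w0 wint g)
    qed
    also have "\<dots> = (LINT x|lborel. g x * (LINT \<xi>|lborel. complex_of_real (w \<xi>) * cis (dilate u (y - x) \<bullet> \<xi>)))"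
      by (simp flip: integral_mult_right_zero add: dilate_diff inner_diff_left cis_divide[symmetric] cis_inverse[symmetric] field_simps)
    finally show ?thesis
      unfolding WG .
  qed

  have wF: "integrable lborel (\<lambda>\<xi>. w \<xi> * (cmod (F \<xi>))\<^sup>2)"
    by (rule Bochner_Integration.integrable_bound[of _ "\<lambda>\<xi>. w \<xi> * I\<^sup>2"])
       (auto intro!: wint mult_left_mono power_mono FI simp: w0 abs_mult)
  have "complex_of_real (LINT \<xi>|lborel. w \<xi> * (cmod (F \<xi>))\<^sup>2)
      = (LINT \<xi>|lborel. complex_of_real (w \<xi>) * F \<xi> * cnj (F \<xi>))"
    by (simp flip: integral_complex_of_real complex_norm_square add: mult.assoc)
  also have "\<dots> = (LINT \<xi>|lborel. LINT y|lborel. complex_of_real (w \<xi>) * F \<xi> * (cnj (g y) * cis (dilate u y \<bullet> \<xi>)))"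
  proof -
    have "cnj (F \<xi>) = (LINT y|lborel. cnj (g y) * cis (dilate u y \<bullet> \<xi>))" for \<xi>
      unfolding F_def by (subst Bochner_Integration.integral_cnj[symmetric]) (simp add: cis_cnj)
    thus ?thesis by simp
  qed
  also have "\<dots> = (LINT y|lborel. LINT \<xi>|lborel. complex_of_real (w \<xi>) * F \<xi> * (cnj (g y) * cis (dilate u y \<bullet> \<xi>)))"
  proof (rule lborel_pair.Fubini_integral)
    show "integrable (lborel \<Otimes>\<^sub>M lborel) (\<lambda>(y, \<xi>). complex_of_real (w \<xi>) * F \<xi> * (cnj (g y) * cis (dilate u y \<bullet> \<xi>)))"
    proof (rule lborel_integrable_product_bound[where A="\<lambda>x. cmod (g x)" and B="\<lambda>\<xi>. w \<xi> * I"])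
      show "cmod (case (y, \<xi>) of (y, \<xi>) \<Rightarrow> complex_of_real (w \<xi>) * F \<xi> * (cnj (g y) * cis (dilate u y \<bullet> \<xi>))) \<le> cmod (g y) * (w \<xi> * I)" for y \<xi>
        using mult_left_mono[OF FI[of \<xi>], of "cmod (g y) * w \<xi>"] by (simp add: norm_mult w0 mult_ac)
      show "(\<lambda>(y, \<xi>). complex_of_real (w \<xi>) * F \<xi> * (cnj (g y) * cis (dilate u y \<bullet> \<xi>))) \<in> borel_measurable (lborel \<Otimes>\<^sub>M lborel)"
        by measurable
    qed (auto simp: wint g)
  qed
  also have "\<dots> = (LINT y|lborel. cnj (g y) * (LINT \<xi>|lborel. complex_of_real (w \<xi>) * cis (dilate u y \<bullet> \<xi>) * F \<xi>))"
    by (simp flip: integral_mult_right_zero add: mult_ac)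
  also have "\<dots> = (LINT y|lborel. cnj (g y) * (LINT x|lborel. g x * complex_of_real (G (y - x))))"
    unfolding inner ..
  finally have main: "complex_of_real (LINT \<xi>|lborel. w \<xi> * (cmod (F \<xi>))\<^sup>2)
      = (LINT y|lborel. LINT x|lborel. cnj (g y) * (g x * complex_of_real (G (y - x))))"
    by simp

  have "(\<integral>\<^sup>+\<xi>. ennreal (w \<xi> * (cmod (F \<xi>))\<^sup>2) \<partial>lborel) = ennreal (LINT \<xi>|lborel. w \<xi> * (cmod (F \<xi>))\<^sup>2)"
    by (rule nn_integral_eq_integral) (auto simp: wF w0)
  also have "\<dots> = ennreal (cmod (complex_of_real (LINT \<xi>|lborel. w \<xi> * (cmod (F \<xi>))\<^sup>2)))"
    by (simp add: w0 integral_nonneg_AE)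
  also have "\<dots> \<le> (\<integral>\<^sup>+y. \<integral>\<^sup>+x. ennreal (cmod (g y) * cmod (g x) * G (y - x)) \<partial>lborel \<partial>lborel)"
    unfolding main
    by (rule order_trans[OF norm_integral_le_nn_integral], rule nn_integral_mono,
        rule order_trans[OF norm_integral_le_nn_integral])
       (auto simp: norm_mult G0 mult.assoc)
  also have "\<dots> \<le> (\<integral>\<^sup>+y. \<integral>\<^sup>+x. ennreal ((cmod (g y))\<^sup>2 / 2) * ennreal (G (y - x))
                        + ennreal ((cmod (g x))\<^sup>2 / 2) * ennreal (G (y - x)) \<partial>lborel \<partial>lborel)"
  proof (intro nn_integral_mono)
    fix x y :: 'a
    have "cmod (g y) * cmod (g x) \<le> (cmod (g y))\<^sup>2 / 2 + (cmod (g x))\<^sup>2 / 2"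
      using sum_squares_bound[of "cmod (g y)" "cmod (g x)"] by simp
    from mult_right_mono[OF this G0]
    show "ennreal (cmod (g y) * cmod (g x) * G (y - x)) \<le> ennreal ((cmod (g y))\<^sup>2 / 2) * ennreal (G (y - x))
                        + ennreal ((cmod (g x))\<^sup>2 / 2) * ennreal (G (y - x))"
      by (simp add: ennreal_mult'[symmetric] ennreal_plus[symmetric] G0 distrib_right del: ennreal_plus)
  qed
  also have "\<dots> = (\<integral>\<^sup>+y. \<integral>\<^sup>+x. ennreal ((cmod (g y))\<^sup>2 / 2) * ennreal (G (y - x)) \<partial>lborel \<partial>lborel)
       + (\<integral>\<^sup>+y. \<integral>\<^sup>+x. ennreal ((cmod (g x))\<^sup>2 / 2) * ennreal (G (y - x)) \<partial>lborel \<partial>lborel)"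
    by (simp add: nn_integral_add)
  also have "(\<integral>\<^sup>+y. \<integral>\<^sup>+x. ennreal ((cmod (g x))\<^sup>2 / 2) * ennreal (G (y - x)) \<partial>lborel \<partial>lborel)
     = (\<integral>\<^sup>+x. \<integral>\<^sup>+y. ennreal ((cmod (g x))\<^sup>2 / 2) * ennreal (G (y - x)) \<partial>lborel \<partial>lborel)"
    by (rule lborel_pair.Fubini') measurable
  also have "\<dots> = (\<integral>\<^sup>+y. \<integral>\<^sup>+x. ennreal ((cmod (g y))\<^sup>2 / 2) * ennreal (G (y - x)) \<partial>lborel \<partial>lborel)"
  proof -
    have "G (y - x) = G (x - y)" for x y
      by (simp add: G_def dilate_diff norm_minus_commute)
    thus ?thesis by simp
  qed
  also have "\<dots> = (\<integral>\<^sup>+y. ennreal ((cmod (g y))\<^sup>2 / 2) * ennreal P \<partial>lborel)"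
  proof -
    have "(\<integral>\<^sup>+x. ennreal (G (y - x)) \<partial>lborel) = ennreal P" for y
    proof -
      have "(\<integral>\<^sup>+x. ennreal (G (y - x)) \<partial>lborel) = (\<integral>\<^sup>+x. ennreal (G (- y + x)) \<partial>lborel)"
        by (simp add: G_def dilate_diff norm_minus_commute)
      also have "\<dots> = (\<integral>\<^sup>+x. ennreal (G x) \<partial>distr lborel borel ((+) (- y)))"
        by (subst nn_integral_distr) auto
      also have "\<dots> = (\<integral>\<^sup>+x. ennreal (G x) \<partial>lborel)"
        unfolding lborel_distr_plus ..
      also have "\<dots> = ennreal P"
        unfolding G_def P_def using gaussian_nn_integral_dilate[OF e u] by simp
      finally show ?thesis .
    qed
    thus ?thesis
      by (simp add: nn_integral_cmult)
  qed
  also have "\<dots> + \<dots> = ennreal P * (\<integral>\<^sup>+x. ennreal ((cmod (g x))\<^sup>2) \<partial>lborel)"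
  proof -
    have "ennreal ((cmod (g x))\<^sup>2) = ennreal ((cmod (g x))\<^sup>2 / 2) + ennreal ((cmod (g x))\<^sup>2 / 2)" for x
      by (simp flip: ennreal_plus)
    thus ?thesis
      by (simp add: nn_integral_add nn_integral_cmult mult.commute distrib_left)
  qed
  finally show ?thesis
    unfolding w_def P_def .
qed

text \<open>The weights tend to \<open>1\<close> as their width parameter tends to \<open>0\<close>, and the weighted bound does not
  depend on it, so Fatou's lemma removes the weight.\<close>

lemma Fourier_square_integral_bound:
  fixes g :: "'a::euclidean_space \<Rightarrow> complex" and u :: 'a
  assumes g: "integrable lborel g" and u: "\<And>b. b \<in> Basis \<Longrightarrow> u \<bullet> b \<noteq> 0"
  defines "F \<equiv> (\<lambda>\<xi>. LINT x|lborel. g x * cis (- (dilate u x \<bullet> \<xi>)))"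
  shows "(\<integral>\<^sup>+\<xi>. ennreal ((cmod (F \<xi>))\<^sup>2) \<partial>lborel)
       \<le> ennreal (\<Prod>b\<in>Basis. 2 * pi / \<bar>u \<bullet> b\<bar>) * (\<integral>\<^sup>+x. ennreal ((cmod (g x))\<^sup>2) \<partial>lborel)"
proof -
  note [measurable] = borel_measurable_integrable[OF g]
  have [measurable]: "F \<in> borel_measurable borel"
    unfolding F_def by measurable
  let ?f = "\<lambda>n \<xi>. ennreal (exp (- (norm (inverse (real (Suc n)) *\<^sub>R \<xi>))\<^sup>2 / 2) * (cmod (F \<xi>))\<^sup>2)"
  have "(\<lambda>n. ?f n \<xi>) \<longlonglongrightarrow> ennreal (exp (- (norm (0 *\<^sub>R \<xi>))\<^sup>2 / 2) * (cmod (F \<xi>))\<^sup>2)" for \<xi>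
    by (intro tendsto_intros LIMSEQ_inverse_real_of_nat) auto
  hence "liminf (\<lambda>n. ?f n \<xi>) = ennreal ((cmod (F \<xi>))\<^sup>2)" for \<xi>
    by (intro lim_imp_Liminf) auto
  hence "(\<integral>\<^sup>+\<xi>. ennreal ((cmod (F \<xi>))\<^sup>2) \<partial>lborel) = (\<integral>\<^sup>+\<xi>. liminf (\<lambda>n. ?f n \<xi>) \<partial>lborel)"
    by simp
  also have "\<dots> \<le> liminf (\<lambda>n. \<integral>\<^sup>+\<xi>. ?f n \<xi> \<partial>lborel)"
    by (rule nn_integral_liminf) measurable
  also have "\<dots> \<le> limsup (\<lambda>n. \<integral>\<^sup>+\<xi>. ?f n \<xi> \<partial>lborel)"
    by (rule Liminf_le_Limsup) simp
  also have "\<dots> \<le> ennreal (\<Prod>b\<in>Basis. 2 * pi / \<bar>u \<bullet> b\<bar>) * (\<integral>\<^sup>+x. ennreal ((cmod (g x))\<^sup>2) \<partial>lborel)"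
    unfolding F_def
    by (rule Limsup_bounded, rule always_eventually, rule allI,
        rule gaussian_weighted_Fourier_bound[OF g _ u]) auto
  finally show ?thesis .
qed

section \<open>The transform on integrable functions\<close>

text \<open>The square of the \<open>L\<^sup>2\<close> norm. Only orders of magnitude matter below, so the inequality
  \<open>(a + b)\<^sup>2 \<le> 2 a\<^sup>2 + 2 b\<^sup>2\<close> takes the place of Minkowski's inequality and no square roots occur.\<close>

definition sq_integral :: "('a::euclidean_space \<Rightarrow> complex) \<Rightarrow> ennreal" where
  "sq_integral f = (\<integral>\<^sup>+x. ennreal ((cmod (f x))\<^sup>2) \<partial>lebesgue)"

definition frequency_scale :: "real ^ 'n \<Rightarrow> real \<Rightarrow> real ^ 'n" where
  "frequency_scale \<alpha> lam = (\<chi> k. lam\<^sup>2 / sin (\<alpha> $ k))"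

definition kernel_bound :: "real ^ 'n \<Rightarrow> real" where
  "kernel_bound \<alpha> = cmod (mfrft_C \<alpha>) / sqrt (2 * pi) ^ CARD('n)"

lemma chirp_cis: "chirp \<alpha> lam x = cis (lam\<^sup>2 * (\<Sum>k\<in>UNIV. mfrft_a (\<alpha> $ k) * (x $ k)\<^sup>2))"
  unfolding chirp_def cis_conv_exp by simp

lemma norm_chirp [simp]: "cmod (chirp \<alpha> lam x) = 1"
  by (simp add: chirp_cis)

lemma borel_measurable_chirp [measurable]: "chirp \<alpha> lam \<in> borel_measurable borel"
  unfolding chirp_cis[abs_def] cart_eq_inner_axis by measurable

lemma dilate_frequency_scale:
  "dilate (frequency_scale \<alpha> lam) x \<bullet> \<xi> = lam\<^sup>2 * (\<Sum>k\<in>UNIV. x $ k * \<xi> $ k * (1 / sin (\<alpha> $ k)))"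
proof -
  have "dilate (frequency_scale \<alpha> lam) x $ k = lam\<^sup>2 / sin (\<alpha> $ k) * x $ k" for k
  proof -
    have "dilate (frequency_scale \<alpha> lam) x \<bullet> axis k 1
        = (frequency_scale \<alpha> lam \<bullet> axis k 1) * (x \<bullet> axis k 1)"
      by (rule dilate_inner_Basis) (simp add: Basis_vec_def axis_eq_axis)
    thus ?thesis
      by (simp add: inner_axis frequency_scale_def)
  qed
  thus ?thesis
    by (simp add: inner_vec_def sum_distrib_left mult_ac)
qed

lemma mfrft_kernel_eq:
  fixes \<alpha> :: "real ^ 'n"
  shows "mfrft_kernel \<alpha> lam x \<xi> = mfrft_C \<alpha> / complex_of_real (sqrt (2 * pi) ^ CARD('n)) * chirp \<alpha> lam \<xi>
     * (chirp \<alpha> lam x * cis (- (dilate (frequency_scale \<alpha> lam) x \<bullet> \<xi>)))"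
  unfolding mfrft_kernel_def dilate_frequency_scale cis_conv_exp by (simp add: mult_ac)

lemma norm_mfrft_kernel: "cmod (mfrft_kernel \<alpha> lam x \<xi>) = kernel_bound \<alpha>"
  by (simp add: mfrft_kernel_eq norm_mult norm_divide norm_power kernel_bound_def)

lemma borel_measurable_mfrft_kernel [measurable]:
  "(\<lambda>x. mfrft_kernel \<alpha> lam x \<xi>) \<in> borel_measurable borel"
  unfolding mfrft_kernel_eq by measurable

lemma lebesgue_measurable_if_borel:
  "f \<in> borel_measurable borel \<Longrightarrow> f \<in> borel_measurable lebesgue"
  by (rule measurable_completion) simp

text \<open>Fubini's theorem was applied to Borel functions on \<open>lborel\<close>; this transfers its consequences to
  Lebesgue measurable functions.\<close>

lemma lebesgue_complex_borel_version:
  fixes f :: "'a::euclidean_space \<Rightarrow> complex"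
  assumes [measurable]: "f \<in> borel_measurable lebesgue"
  obtains f' where "f' \<in> borel_measurable borel" "AE x in lborel. f x = f' x"
proof -
  have r: "(\<lambda>x. Re (f x)) \<in> borel_measurable lebesgue" "(\<lambda>x. Im (f x)) \<in> borel_measurable lebesgue"
    by measurable
  obtain p q where pq: "p \<in> borel_measurable lborel" "AE x in lborel. Re (f x) = p x"
    "q \<in> borel_measurable lborel" "AE x in lborel. Im (f x) = q x"
    using completion_ex_borel_measurable_real[OF r(1)] completion_ex_borel_measurable_real[OF r(2)] by blast
  show thesis
  proof
    from pq(1,3) show "(\<lambda>x. complex_of_real (p x) + \<i> * complex_of_real (q x)) \<in> borel_measurable borel"
      by (simp add: borel_measurable_add borel_measurable_times borel_measurable_of_real)
    show "AE x in lborel. f x = complex_of_real (p x) + \<i> * complex_of_real (q x)"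
      using pq(2,4) by eventually_elim (metis complex_eq)
  qed
qed

lemma mfrft_L1_integrand:
  assumes "integrable lebesgue h"
  shows "integrable lebesgue (\<lambda>x. h x * mfrft_kernel \<alpha> lam x \<xi>)"
proof (rule Bochner_Integration.integrable_bound)
  show "integrable lebesgue (\<lambda>x. of_real (kernel_bound \<alpha>) * h x)"
    using assms by simp
  show "(\<lambda>x. h x * mfrft_kernel \<alpha> lam x \<xi>) \<in> borel_measurable lebesgue"
    using assms
    by (intro borel_measurable_times lebesgue_measurable_if_borel[OF borel_measurable_mfrft_kernel]) auto
  have "kernel_bound \<alpha> \<ge> 0" by (simp add: kernel_bound_def)
  thus "AE x in lebesgue. cmod (h x * mfrft_kernel \<alpha> lam x \<xi>) \<le> cmod (of_real (kernel_bound \<alpha>) * h x)"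
    by (simp add: norm_mult norm_mfrft_kernel mult.commute)
qed

lemma mfrft_L1_diff:
  assumes "integrable lebesgue h" "integrable lebesgue p"
  shows "mfrft_L1 \<alpha> lam (\<lambda>x. h x - p x) = (\<lambda>\<xi>. mfrft_L1 \<alpha> lam h \<xi> - mfrft_L1 \<alpha> lam p \<xi>)"
  unfolding mfrft_L1_def left_diff_distrib
  by (rule ext, rule Bochner_Integration.integral_diff) (intro mfrft_L1_integrand assms)+

lemma norm_mfrft_L1:
  "ennreal (cmod (mfrft_L1 \<alpha> lam h \<xi>)) \<le> ennreal (kernel_bound \<alpha>) * (\<integral>\<^sup>+x. ennreal (cmod (h x)) \<partial>lebesgue)"
  if "h \<in> borel_measurable lebesgue"
proof -
  have "kernel_bound \<alpha> \<ge> 0" by (simp add: kernel_bound_def)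
  have "ennreal (cmod (mfrft_L1 \<alpha> lam h \<xi>)) \<le> (\<integral>\<^sup>+x. ennreal (cmod (h x * mfrft_kernel \<alpha> lam x \<xi>)) \<partial>lebesgue)"
    unfolding mfrft_L1_def by (rule norm_integral_le_nn_integral)
  also have "\<dots> = (\<integral>\<^sup>+x. ennreal (kernel_bound \<alpha>) * ennreal (cmod (h x)) \<partial>lebesgue)"
    using \<open>kernel_bound \<alpha> \<ge> 0\<close> by (simp add: norm_mult norm_mfrft_kernel ennreal_mult' mult.commute)
  also have "\<dots> = ennreal (kernel_bound \<alpha>) * (\<integral>\<^sup>+x. ennreal (cmod (h x)) \<partial>lebesgue)"
    using that by (intro nn_integral_cmult) auto
  finally show ?thesis .
qed

text \<open>The chirp in \<open>\<xi>\<close> has modulus one and stays outside; the chirp in \<open>x\<close> is absorbed into the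
  transformed function. Up to these factors the transform is a Fourier transform with rescaled
  frequencies.\<close>

lemma mfrft_L1_eq_Fourier:
  fixes \<alpha> :: "real ^ 'n"
  assumes "integrable lebesgue h"
  obtains g where "integrable lborel g" "sq_integral h = (\<integral>\<^sup>+x. ennreal ((cmod (g x))\<^sup>2) \<partial>lborel)"
    "\<And>\<xi>. mfrft_L1 \<alpha> lam h \<xi> = mfrft_C \<alpha> / complex_of_real (sqrt (2 * pi) ^ CARD('n)) * chirp \<alpha> lam \<xi>
        * (LINT x|lborel. g x * cis (- (dilate (frequency_scale \<alpha> lam) x \<bullet> \<xi>)))"
proof -
  have hm: "h \<in> borel_measurable lebesgue" using assms by auto
  from lebesgue_complex_borel_version[OF hm]
  obtain h' where [measurable]: "h' \<in> borel_measurable borel" and h': "AE x in lborel. h x = h' x" by blast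
  let ?g = "\<lambda>x. h' x * chirp \<alpha> lam x"
  from h' have AE: "AE x in lebesgue. h x = h' x" by (rule AE_completion)
  have ih': "integrable lebesgue h'"
    using assms by (rule integrable_cong_AE_imp) (use AE in \<open>auto intro: lebesgue_measurable_if_borel\<close>)
  hence i': "integrable lborel h'"
    by (simp add: integrable_completion)
  show thesis
  proof
    show "integrable lborel ?g"
      by (rule Bochner_Integration.integrable_bound[OF i']) (auto simp: norm_mult)
    have "sq_integral h = (\<integral>\<^sup>+x. ennreal ((cmod (h x))\<^sup>2) \<partial>lborel)"
      unfolding sq_integral_def by (simp add: nn_integral_completion)
    also have "\<dots> = (\<integral>\<^sup>+x. ennreal ((cmod (?g x))\<^sup>2) \<partial>lborel)"
      by (rule nn_integral_cong_AE) (use h' in \<open>auto simp: norm_mult\<close>)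
    finally show "sq_integral h = (\<integral>\<^sup>+x. ennreal ((cmod (?g x))\<^sup>2) \<partial>lborel)" .
    fix \<xi> :: "real ^ 'n"
    have "mfrft_L1 \<alpha> lam h \<xi> = (LINT x|lebesgue. h' x * mfrft_kernel \<alpha> lam x \<xi>)"
      unfolding mfrft_L1_def
      by (rule integral_cong_AE)
         (use AE in \<open>auto intro!: borel_measurable_integrable mfrft_L1_integrand assms ih'\<close>)
    also have "\<dots> = (LINT x|lborel. h' x * mfrft_kernel \<alpha> lam x \<xi>)"
      by (rule integral_completion) measurable
    also have "\<dots> = (LINT x|lborel. mfrft_C \<alpha> / complex_of_real (sqrt (2 * pi) ^ CARD('n)) * chirp \<alpha> lam \<xi>
        * (?g x * cis (- (dilate (frequency_scale \<alpha> lam) x \<bullet> \<xi>))))"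
      unfolding mfrft_kernel_eq by (simp add: mult_ac)
    finally show "mfrft_L1 \<alpha> lam h \<xi> = mfrft_C \<alpha> / complex_of_real (sqrt (2 * pi) ^ CARD('n)) * chirp \<alpha> lam \<xi>
        * (LINT x|lborel. ?g x * cis (- (dilate (frequency_scale \<alpha> lam) x \<bullet> \<xi>)))"
      by (simp only: integral_mult_right_zero)
  qed
qed

lemma borel_measurable_mfrft_L1:
  assumes "integrable lebesgue h"
  shows "mfrft_L1 \<alpha> lam h \<in> borel_measurable borel"
proof -
  obtain g where g: "integrable lborel g"
    and eq: "\<And>\<xi>. mfrft_L1 \<alpha> lam h \<xi> = mfrft_C \<alpha> / complex_of_real (sqrt (2 * pi) ^ CARD('a)) * chirp \<alpha> lam \<xi>
        * (LINT x|lborel. g x * cis (- (dilate (frequency_scale \<alpha> lam) x \<bullet> \<xi>)))"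
    using mfrft_L1_eq_Fourier[OF assms, of \<alpha> lam] by blast
  note [measurable] = borel_measurable_integrable[OF g]
  show ?thesis
    unfolding eq[abs_def] by measurable
qed

lemma mfrft_L1_square_integral_bound:
  assumes "lam \<noteq> 0" "\<And>k. sin (\<alpha> $ k) \<noteq> 0"
  obtains C where "0 \<le> C" "\<And>h. integrable lebesgue h \<Longrightarrow> sq_integral (mfrft_L1 \<alpha> lam h) \<le> ennreal C * sq_integral h"
proof
  let ?u = "frequency_scale \<alpha> lam"
  define P where "P = (\<Prod>b\<in>Basis. 2 * pi / \<bar>?u \<bullet> b\<bar>)"
  show "0 \<le> (kernel_bound \<alpha>)\<^sup>2 * P"
    unfolding P_def by (intro mult_nonneg_nonneg prod_nonneg) auto
  fix h :: "(real, 'a) vec \<Rightarrow> complex" assume h: "integrable lebesgue h"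
  obtain g where g: "integrable lborel g" and sq: "sq_integral h = (\<integral>\<^sup>+x. ennreal ((cmod (g x))\<^sup>2) \<partial>lborel)"
    and eq: "\<And>\<xi>. mfrft_L1 \<alpha> lam h \<xi> = mfrft_C \<alpha> / complex_of_real (sqrt (2 * pi) ^ CARD('a)) * chirp \<alpha> lam \<xi>
        * (LINT x|lborel. g x * cis (- (dilate ?u x \<bullet> \<xi>)))"
    using mfrft_L1_eq_Fourier[OF h, of \<alpha> lam] by blast
  note [measurable] = borel_measurable_integrable[OF g]
  have u: "?u \<bullet> b \<noteq> 0" if "b \<in> Basis" for b
    using that assms by (auto simp: Basis_vec_def inner_axis frequency_scale_def)
  have "sq_integral (mfrft_L1 \<alpha> lam h) = (\<integral>\<^sup>+\<xi>. ennreal ((kernel_bound \<alpha>)\<^sup>2)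
      * ennreal ((cmod (LINT x|lborel. g x * cis (- (dilate ?u x \<bullet> \<xi>))))\<^sup>2) \<partial>lborel)"
    unfolding sq_integral_def nn_integral_completion eq
    by (simp add: norm_mult norm_divide norm_power kernel_bound_def power_mult_distrib power_divide flip: ennreal_mult')
  also have "\<dots> = ennreal ((kernel_bound \<alpha>)\<^sup>2) * (\<integral>\<^sup>+\<xi>. ennreal ((cmod (LINT x|lborel. g x * cis (- (dilate ?u x \<bullet> \<xi>))))\<^sup>2) \<partial>lborel)"
    by (rule nn_integral_cmult) measurable
  also have "\<dots> \<le> ennreal ((kernel_bound \<alpha>)\<^sup>2) * (ennreal P * sq_integral h)"
    unfolding P_def sq by (intro mult_left_mono Fourier_square_integral_bound g u) auto
  finally show "sq_integral (mfrft_L1 \<alpha> lam h) \<le> ennreal ((kernel_bound \<alpha>)\<^sup>2 * P) * sq_integral h"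
    by (simp add: ennreal_mult' mult.assoc)
qed

section \<open>The extension to square integrable functions\<close>

lemma L2_enorm_power2: "(L2_enorm f)\<^sup>2 = sq_integral f"
proof (cases "sq_integral f" rule: ennreal_cases)
  case (real r)
  thus ?thesis
    by (simp add: L2_enorm_def sq_integral_def[symmetric] epowr_def ennreal_power powr_half_sqrt)
next
  case top
  thus ?thesis
    by (simp add: L2_enorm_def sq_integral_def[symmetric] epowr_def top_power_ennreal)
qed

lemma L2_space_iff: "f \<in> L2_space \<longleftrightarrow> f \<in> borel_measurable lebesgue \<and> sq_integral f < \<infinity>"
  unfolding L2_space_def L2_enorm_power2[symmetric] by (auto simp: power_less_top_ennreal)

lemma L2_enorm_tendsto_0_iff:
  "((\<lambda>n. L2_enorm (u n)) \<longlonglongrightarrow> 0) \<longleftrightarrow> ((\<lambda>n. sq_integral (u n)) \<longlonglongrightarrow> 0)"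
proof
  assume L: "(\<lambda>n. L2_enorm (u n)) \<longlonglongrightarrow> 0"
  show "(\<lambda>n. sq_integral (u n)) \<longlonglongrightarrow> 0"
  proof (rule order_tendstoI)
    fix e :: ennreal assume "0 < e"
    hence "\<forall>\<^sub>F n in sequentially. L2_enorm (u n) < min e 1"
      using order_tendstoD(2)[OF L, of "min e 1"] by simp
    thus "\<forall>\<^sub>F n in sequentially. sq_integral (u n) < e"
    proof eventually_elim
      case (elim n)
      hence "L2_enorm (u n) * L2_enorm (u n) \<le> L2_enorm (u n) * 1"
        by (intro mult_left_mono) auto
      thus ?case
        using elim by (auto simp: L2_enorm_power2[symmetric] power2_eq_square intro: le_less_trans)
    qed
  qed simp
next
  assume S: "(\<lambda>n. sq_integral (u n)) \<longlonglongrightarrow> 0"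
  show "(\<lambda>n. L2_enorm (u n)) \<longlonglongrightarrow> 0"
  proof (rule order_tendstoI)
    fix e :: ennreal assume "0 < e"
    hence "0 < e\<^sup>2"
      by (simp add: power2_eq_square ennreal_zero_less_mult_iff)
    from order_tendstoD(2)[OF S this] show "\<forall>\<^sub>F n in sequentially. L2_enorm (u n) < e"
    proof eventually_elim
      case (elim n)
      thus ?case
        using power_mono[of e "L2_enorm (u n)" 2] by (force simp: L2_enorm_power2 not_less[symmetric])
    qed
  qed simp
qed

lemma sq_integral_minus_commute: "sq_integral (\<lambda>x. f x - g x) = sq_integral (\<lambda>x. g x - f x)"
  by (simp add: sq_integral_def norm_minus_commute)

lemma sq_integral_minus: "sq_integral (\<lambda>x. - f x) = sq_integral f"
  by (simp add: sq_integral_def)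

lemma sq_integral_triangle:
  assumes [measurable]: "f \<in> borel_measurable lebesgue" "g \<in> borel_measurable lebesgue" "h \<in> borel_measurable lebesgue"
  shows "sq_integral (\<lambda>x. f x - g x) \<le> 2 * sq_integral (\<lambda>x. f x - h x) + 2 * sq_integral (\<lambda>x. h x - g x)"
proof -
  have "sq_integral (\<lambda>x. f x - g x) \<le> (\<integral>\<^sup>+x. 2 * ennreal ((cmod (f x - h x))\<^sup>2) + 2 * ennreal ((cmod (h x - g x))\<^sup>2) \<partial>lebesgue)"
    unfolding sq_integral_def
  proof (rule nn_integral_mono)
    fix x
    have "cmod (f x - g x) \<le> cmod (f x - h x) + cmod (h x - g x)"
      using norm_triangle_ineq[of "f x - h x" "h x - g x"] by simp
    hence "(cmod (f x - g x))\<^sup>2 \<le> (cmod (f x - h x) + cmod (h x - g x))\<^sup>2"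
      by (intro power_mono) auto
    also have "\<dots> \<le> 2 * (cmod (f x - h x))\<^sup>2 + 2 * (cmod (h x - g x))\<^sup>2"
      using sum_squares_bound[of "cmod (f x - h x)" "cmod (h x - g x)"] by (simp add: power2_sum)
    finally have "ennreal ((cmod (f x - g x))\<^sup>2) \<le> ennreal (2 * (cmod (f x - h x))\<^sup>2 + 2 * (cmod (h x - g x))\<^sup>2)"
      by (rule ennreal_leI)
    thus "ennreal ((cmod (f x - g x))\<^sup>2) \<le> 2 * ennreal ((cmod (f x - h x))\<^sup>2) + 2 * ennreal ((cmod (h x - g x))\<^sup>2)"
      by (simp add: ennreal_mult')
  qed
  also have "\<dots> = 2 * sq_integral (\<lambda>x. f x - h x) + 2 * sq_integral (\<lambda>x. h x - g x)"
    unfolding sq_integral_def by (subst nn_integral_add) (auto simp: nn_integral_cmult)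
  finally show ?thesis .
qed

lemma L2_diff:
  assumes "f \<in> L2_space" "g \<in> L2_space"
  shows "(\<lambda>x. f x - g x) \<in> L2_space"
proof -
  have "sq_integral (\<lambda>x. f x - g x) \<le> 2 * sq_integral (\<lambda>x. f x - 0) + 2 * sq_integral (\<lambda>x. 0 - g x)"
    using assms by (intro sq_integral_triangle) (auto simp: L2_space_iff)
  also have "\<dots> < \<infinity>"
    using assms by (simp add: L2_space_iff sq_integral_minus ennreal_mult_less_top)
  finally show ?thesis
    using assms by (auto simp: L2_space_iff)
qed

text \<open>Completeness of \<open>L\<^sup>2\<close>. Geometric decay permits the weights \<open>2 ^ n\<close>: the series of
  \<open>2 ^ n |u (n + 1) - u n|\<^sup>2\<close> has finite integral, so it converges almost everywhere, and by
  \<open>2 a \<le> 2 ^ n a\<^sup>2 + 2 ^ (- n)\<close> so does the telescoping series of the differences. Fatou's lemma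
  then bounds the distance to the pointwise limit.\<close>

lemma geometric_Cauchy_L2_limit:
  fixes u :: "nat \<Rightarrow> 'a::euclidean_space \<Rightarrow> complex"
  assumes u [measurable]: "\<And>n. u n \<in> borel_measurable lebesgue"
    and c: "0 \<le> c" and Cauchy: "\<And>n m. n \<le> m \<Longrightarrow> sq_integral (\<lambda>x. u n x - u m x) \<le> ennreal (c * (1 / 4) ^ n)"
  obtains g where "g \<in> borel_measurable lebesgue"
    "\<And>n. sq_integral (\<lambda>x. u n x - g x) \<le> ennreal (c * (1 / 4) ^ n)"
proof -
  define d where "d = (\<lambda>n x. u (Suc n) x - u n x)"
  have [measurable]: "d n \<in> borel_measurable lebesgue" for n
    unfolding d_def by measurable
  have "(\<integral>\<^sup>+x. (\<Sum>n. ennreal (2 ^ n * (cmod (d n x))\<^sup>2)) \<partial>lebesgue) = (\<Sum>n. \<integral>\<^sup>+x. ennreal (2 ^ n * (cmod (d n x))\<^sup>2) \<partial>lebesgue)"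
    by (rule nn_integral_suminf) measurable
  also have "\<dots> = (\<Sum>n. ennreal (2 ^ n) * sq_integral (\<lambda>x. u n x - u (Suc n) x))"
    unfolding sq_integral_def d_def
    by (intro suminf_cong, subst nn_integral_cmult[symmetric])
       (auto simp: ennreal_mult' norm_minus_commute)
  also have "\<dots> \<le> (\<Sum>n. ennreal (c * (1 / 2) ^ n))"
  proof (rule suminf_le)
    fix n
    have "ennreal (2 ^ n) * sq_integral (\<lambda>x. u n x - u (Suc n) x) \<le> ennreal (2 ^ n) * ennreal (c * (1 / 4) ^ n)"
      by (intro mult_left_mono Cauchy) auto
    also have "\<dots> = ennreal (c * (1 / 2) ^ n)"
    proof -
      have "(2::real) ^ n * (1 / 4) ^ n = (1 / 2) ^ n"
        by (simp flip: power_mult_distrib)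
      thus ?thesis
        using c by (simp add: ennreal_mult'[symmetric] mult.left_commute)
    qed
    finally show "ennreal (2 ^ n) * sq_integral (\<lambda>x. u n x - u (Suc n) x) \<le> ennreal (c * (1 / 2) ^ n)" .
  qed auto
  also have "\<dots> = ennreal (\<Sum>n. c * (1 / 2) ^ n)"
    using c by (intro suminf_ennreal2) (auto intro: summable_mult summable_geometric)
  finally have "(\<integral>\<^sup>+x. (\<Sum>n. ennreal (2 ^ n * (cmod (d n x))\<^sup>2)) \<partial>lebesgue) \<noteq> \<infinity>"
    by (auto simp: top_unique)
  hence "AE x in lebesgue. (\<Sum>n. ennreal (2 ^ n * (cmod (d n x))\<^sup>2)) \<noteq> \<infinity>"
    by (intro nn_integral_PInf_AE) measurable
  hence conv: "AE x in lebesgue. convergent (\<lambda>n. u n x)"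
  proof eventually_elim
    case (elim x)
    hence "summable (\<lambda>n. 2 ^ n * (cmod (d n x))\<^sup>2)"
      by (intro summable_suminf_not_top) auto
    moreover have "summable (\<lambda>n. (1 / 2 :: real) ^ n)"
      by (rule summable_geometric) simp
    ultimately have s: "summable (\<lambda>n. 2 ^ n * (cmod (d n x))\<^sup>2 + (1 / 2) ^ n)"
      by (rule summable_add)
    have "summable (\<lambda>n. d n x)"
    proof (rule summable_comparison_test'[OF s, of 0])
      fix n :: nat
      let ?s = "sqrt (2 ^ n)"
      have "2 * (?s * cmod (d n x)) * (1 / ?s) \<le> (?s * cmod (d n x))\<^sup>2 + (1 / ?s)\<^sup>2"
        by (rule sum_squares_bound)
      hence "2 * cmod (d n x) \<le> 2 ^ n * (cmod (d n x))\<^sup>2 + (1 / 2) ^ n"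
        by (simp add: power_mult_distrib power_divide)
      thus "cmod (d n x) \<le> 2 ^ n * (cmod (d n x))\<^sup>2 + (1 / 2) ^ n"
        using norm_ge_zero[of "d n x"] by linarith
    qed
    hence "convergent (\<lambda>n. u n x - u 0 x)"
      by (simp add: summable_iff_convergent d_def sum_lessThan_telescope[of "\<lambda>n. u n x"])
    hence "convergent (\<lambda>n. (u n x - u 0 x) + u 0 x)"
      by (intro convergent_add convergent_const)
    thus ?case by simp
  qed
  define g where "g = (\<lambda>x. lim (\<lambda>n. u n x))"
  have [measurable]: "g \<in> borel_measurable lebesgue"
    unfolding g_def by (rule borel_measurable_lim_metric) measurable
  show thesis
  proof (rule that)
    fix n
    have "sq_integral (\<lambda>x. u n x - g x) = (\<integral>\<^sup>+x. liminf (\<lambda>m. ennreal ((cmod (u n x - u m x))\<^sup>2)) \<partial>lebesgue)"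
      unfolding sq_integral_def
    proof (rule nn_integral_cong_AE, use conv in eventually_elim)
      case (elim x)
      hence "(\<lambda>m. u m x) \<longlonglongrightarrow> g x"
        unfolding g_def by (simp add: convergent_LIMSEQ_iff)
      hence "(\<lambda>m. ennreal ((cmod (u n x - u m x))\<^sup>2)) \<longlonglongrightarrow> ennreal ((cmod (u n x - g x))\<^sup>2)"
        by (intro tendsto_intros)
      thus ?case
        by (intro lim_imp_Liminf[symmetric]) auto
    qed
    also have "\<dots> \<le> liminf (\<lambda>m. sq_integral (\<lambda>x. u n x - u m x))"
      unfolding sq_integral_def by (rule nn_integral_liminf) measurable
    also have "\<dots> \<le> limsup (\<lambda>m. sq_integral (\<lambda>x. u n x - u m x))"
      by (rule Liminf_le_Limsup) simp
    also have "\<dots> \<le> ennreal (c * (1 / 4) ^ n)"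
      by (rule Limsup_bounded) (use Cauchy in \<open>auto simp: eventually_sequentially\<close>)
    finally show "sq_integral (\<lambda>x. u n x - g x) \<le> ennreal (c * (1 / 4) ^ n)" .
  qed measurable
qed

lemma L2_indicator:
  assumes "f \<in> L2_space" "S \<in> sets lebesgue"
  shows "(\<lambda>x. indicator S x * f x) \<in> L2_space"
proof -
  have "sq_integral (\<lambda>x. indicator S x * f x) \<le> sq_integral f"
    unfolding sq_integral_def by (intro nn_integral_mono) (auto simp: indicator_def)
  thus ?thesis
    using assms by (auto simp: L2_space_iff)
qed

lemma L2_cball_integrable:
  fixes f :: "'a::euclidean_space \<Rightarrow> complex"
  assumes "f \<in> L2_space"
  shows "integrable lebesgue (\<lambda>x. indicator (cball 0 r) x * f x)"
proof (rule integrableI_bounded)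
  have [measurable]: "f \<in> borel_measurable lebesgue" "cball 0 r \<in> sets lebesgue"
    using assms by (auto simp: L2_space_iff)
  show "(\<lambda>x. indicator (cball 0 r) x * f x) \<in> borel_measurable lebesgue"
    by measurable
  have "(\<integral>\<^sup>+x. ennreal (cmod (indicator (cball 0 r) x * f x)) \<partial>lebesgue)
      \<le> (\<integral>\<^sup>+x. ennreal ((cmod (f x))\<^sup>2) + indicator (cball 0 r) x \<partial>lebesgue)"
  proof (rule nn_integral_mono)
    fix x :: 'a
    have "cmod (f x) \<le> (cmod (f x))\<^sup>2 + 1"
      using sum_squares_bound[of "cmod (f x)" 1] norm_ge_zero[of "f x"] by (simp del: norm_ge_zero)
    hence "ennreal (cmod (f x)) \<le> ennreal ((cmod (f x))\<^sup>2) + 1"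
      using ennreal_leI by (fastforce simp flip: ennreal_plus ennreal_1)
    thus "ennreal (cmod (indicator (cball 0 r) x * f x)) \<le> ennreal ((cmod (f x))\<^sup>2) + indicator (cball 0 r) x"
      by (auto simp: indicator_def)
  qed
  also have "\<dots> = sq_integral f + emeasure lebesgue (cball (0::'a) r)"
    unfolding sq_integral_def by (subst nn_integral_add) auto
  also have "\<dots> < \<infinity>"
    using assms emeasure_bounded_finite[of "cball (0::'a) r"] by (simp add: L2_space_iff)
  finally show "(\<integral>\<^sup>+x. ennreal (cmod (indicator (cball 0 r) x * f x)) \<partial>lebesgue) < \<infinity>" .
qed

lemma L1_L2_dense:
  fixes f :: "'a::euclidean_space \<Rightarrow> complex"
  assumes f: "f \<in> L2_space" and "0 < e"
  obtains p where "integrable lebesgue p" "p \<in> L2_space" "sq_integral (\<lambda>x. p x - f x) < ennreal e"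
proof -
  have [measurable]: "f \<in> borel_measurable lebesgue" "cball 0 r \<in> sets lebesgue" for r
    using f by (auto simp: L2_space_iff)
  let ?p = "\<lambda>n x. indicator (cball 0 (real n)) x * f x"
  have "(\<lambda>n. sq_integral (\<lambda>x. ?p n x - f x)) \<longlonglongrightarrow> (\<integral>\<^sup>+x. 0 \<partial>(lebesgue::'a measure))"
    unfolding sq_integral_def
  proof (rule nn_integral_dominated_convergence[where w="\<lambda>x. ennreal ((cmod (f x))\<^sup>2)"])
    show "(\<integral>\<^sup>+x. ennreal ((cmod (f x))\<^sup>2) \<partial>lebesgue) < \<infinity>"
      using f by (simp add: L2_space_iff sq_integral_def)
    show "AE x in lebesgue. (\<lambda>n. ennreal ((cmod (?p n x - f x))\<^sup>2)) \<longlonglongrightarrow> 0"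
    proof (rule AE_I2)
      fix x :: 'a
      obtain N where N: "norm x \<le> real N" using real_arch_simple by blast
      hence "ennreal ((cmod (?p n x - f x))\<^sup>2) = 0" if "N \<le> n" for n :: nat
        using that by (auto simp: indicator_def)
      thus "(\<lambda>n. ennreal ((cmod (?p n x - f x))\<^sup>2)) \<longlonglongrightarrow> 0"
        by (intro tendsto_eventually eventually_sequentiallyI)
    qed
    show "(\<lambda>x. ennreal ((cmod (?p n x - f x))\<^sup>2)) \<in> borel_measurable lebesgue" for n
      by measurable
    show "AE x in lebesgue. ennreal ((cmod (?p n x - f x))\<^sup>2) \<le> ennreal ((cmod (f x))\<^sup>2)" for n
      by (auto simp: indicator_def)
  qed auto
  hence "\<forall>\<^sub>F n in sequentially. sq_integral (\<lambda>x. ?p n x - f x) < ennreal e"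
    using \<open>0 < e\<close> by (intro order_tendstoD(2)) auto
  then obtain n where n: "sq_integral (\<lambda>x. ?p n x - f x) < ennreal e"
    by (auto simp: eventually_sequentially)
  show thesis
    by (rule that[OF L2_cball_integrable[OF f] L2_indicator[OF f] n]) simp
qed

text \<open>The transform is a choice among the extensions, so nothing is known about it until one is
  exhibited: the \<open>L\<^sup>2\<close> limit of the transforms of rapidly converging approximations. The Plancherel
  bound shows that every other approximating sequence yields the same limit.\<close>

lemma is_mfrft_extension_mfrft:
  fixes \<alpha> :: "real ^ 'n"
  assumes C: "0 \<le> C" "\<And>h. integrable lebesgue h \<Longrightarrow> sq_integral (mfrft_L1 \<alpha> lam h) \<le> ennreal C * sq_integral h"
    and f: "f \<in> L2_space"
  shows "is_mfrft_extension \<alpha> lam f (mfrft \<alpha> lam f)"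
proof -
  have [measurable]: "f \<in> borel_measurable lebesgue"
    using f by (simp add: L2_space_iff)
  have F_meas: "mfrft_L1 \<alpha> lam h \<in> borel_measurable lebesgue" if "integrable lebesgue h" for h
    using that by (intro lebesgue_measurable_if_borel borel_measurable_mfrft_L1)
  have F_diff: "sq_integral (\<lambda>\<xi>. mfrft_L1 \<alpha> lam h \<xi> - mfrft_L1 \<alpha> lam p \<xi>) \<le> ennreal C * sq_integral (\<lambda>x. h x - p x)"
    if "integrable lebesgue h" "integrable lebesgue p" for h p
    using C(2)[of "\<lambda>x. h x - p x"] that by (simp add: mfrft_L1_diff)
  have "\<forall>n. \<exists>p. integrable lebesgue p \<and> p \<in> L2_space \<and> sq_integral (\<lambda>x. p x - f x) < ennreal ((1 / 4) ^ n)"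
    using L1_L2_dense[OF f] by (metis zero_less_power zero_less_divide_1_iff zero_less_numeral)
  then obtain t where t: "\<And>n. integrable lebesgue (t n)" "\<And>n. t n \<in> L2_space"
    "\<And>n. sq_integral (\<lambda>x. t n x - f x) < ennreal ((1 / 4) ^ n)"
    by metis
  have tm [measurable]: "t n \<in> borel_measurable lebesgue" for n
    using t(1) by auto
  have tt: "sq_integral (\<lambda>x. t n x - t m x) \<le> ennreal (4 * (1 / 4) ^ n)" if "n \<le> m" for n m
  proof -
    have "sq_integral (\<lambda>x. t n x - t m x) \<le> 2 * sq_integral (\<lambda>x. t n x - f x) + 2 * sq_integral (\<lambda>x. f x - t m x)"
      by (rule sq_integral_triangle) measurable
    also have "\<dots> \<le> 2 * ennreal ((1 / 4) ^ n) + 2 * ennreal ((1 / 4) ^ m)"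
      using t(3)[of n] t(3)[of m]
      by (intro add_mono mult_left_mono) (auto simp: sq_integral_minus_commute[of f])
    also have "\<dots> \<le> 2 * ennreal ((1 / 4) ^ n) + 2 * ennreal ((1 / 4) ^ n)"
      using that by (intro add_mono mult_left_mono ennreal_leI power_decreasing) auto
    also have "\<dots> = ennreal (4 * (1 / 4) ^ n)"
      by (simp add: ennreal_mult' flip: distrib_right)
    finally show ?thesis .
  qed
  have Ft: "sq_integral (\<lambda>\<xi>. mfrft_L1 \<alpha> lam (t n) \<xi> - mfrft_L1 \<alpha> lam (t m) \<xi>) \<le> ennreal ((C * 4) * (1 / 4) ^ n)"
    if "n \<le> m" for n m
  proof -
    have "sq_integral (\<lambda>\<xi>. mfrft_L1 \<alpha> lam (t n) \<xi> - mfrft_L1 \<alpha> lam (t m) \<xi>) \<le> ennreal C * ennreal (4 * (1 / 4) ^ n)"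
      by (rule order_trans[OF F_diff[OF t(1) t(1)]]) (intro mult_left_mono tt that, simp)
    thus ?thesis
      using C(1) by (simp add: ennreal_mult'[symmetric] mult.assoc)
  qed
  obtain g where g [measurable]: "g \<in> borel_measurable lebesgue"
    and Fg: "\<And>n. sq_integral (\<lambda>\<xi>. mfrft_L1 \<alpha> lam (t n) \<xi> - g \<xi>) \<le> ennreal ((C * 4) * (1 / 4) ^ n)"
    by (rule geometric_Cauchy_L2_limit[of "\<lambda>n. mfrft_L1 \<alpha> lam (t n)" "C * 4"])
       (use C(1) Ft F_meas t(1) in auto)
  have "is_mfrft_extension \<alpha> lam f g"
    unfolding is_mfrft_extension_def L2_enorm_tendsto_0_iff
  proof (intro conjI allI impI)
    have "sq_integral (mfrft_L1 \<alpha> lam (t 0)) < \<infinity>"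
      using C(2)[OF t(1)[of 0]] t(2)[of 0]
      by (auto simp: L2_space_iff ennreal_mult_less_top elim: le_less_trans)
    hence F0: "mfrft_L1 \<alpha> lam (t 0) \<in> L2_space"
      using F_meas[OF t(1)] by (simp add: L2_space_iff)
    have "(\<lambda>\<xi>. mfrft_L1 \<alpha> lam (t 0) \<xi> - g \<xi>) \<in> L2_space"
      using Fg[of 0] F_meas[OF t(1)] g by (auto simp: L2_space_iff intro: le_less_trans)
    from L2_diff[OF F0 this] show "g \<in> L2_space"
      by simp
    fix h :: "nat \<Rightarrow> real ^ 'n \<Rightarrow> complex"
    assume h: "\<forall>n. integrable lebesgue (h n) \<and> h n \<in> L2_space"
      and lim: "(\<lambda>n. sq_integral (\<lambda>x. h n x - f x)) \<longlonglongrightarrow> 0"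
    have [measurable]: "h n \<in> borel_measurable lebesgue" for n
      using h by (blast intro: borel_measurable_integrable)
    let ?b = "\<lambda>n. 2 * (ennreal C * (2 * sq_integral (\<lambda>x. h n x - f x) + 2 * ennreal ((1 / 4) ^ n)))
        + 2 * ennreal ((C * 4) * (1 / 4) ^ n)"
    have le: "sq_integral (\<lambda>\<xi>. mfrft_L1 \<alpha> lam (h n) \<xi> - g \<xi>) \<le> ?b n" for n
    proof -
      have "sq_integral (\<lambda>\<xi>. mfrft_L1 \<alpha> lam (h n) \<xi> - g \<xi>)
          \<le> 2 * sq_integral (\<lambda>\<xi>. mfrft_L1 \<alpha> lam (h n) \<xi> - mfrft_L1 \<alpha> lam (t n) \<xi>)
            + 2 * sq_integral (\<lambda>\<xi>. mfrft_L1 \<alpha> lam (t n) \<xi> - g \<xi>)"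
        using h t by (intro sq_integral_triangle F_meas g) auto
      also have "\<dots> \<le> 2 * (ennreal C * sq_integral (\<lambda>x. h n x - t n x)) + 2 * ennreal ((C * 4) * (1 / 4) ^ n)"
        using h t by (intro add_mono mult_left_mono F_diff Fg) auto
      also have "\<dots> \<le> 2 * (ennreal C * (2 * sq_integral (\<lambda>x. h n x - f x) + 2 * sq_integral (\<lambda>x. f x - t n x)))
            + 2 * ennreal ((C * 4) * (1 / 4) ^ n)"
        by (intro add_mono mult_left_mono sq_integral_triangle order_refl) auto
      also have "\<dots> \<le> ?b n"
        using t(3)[of n]
        by (intro add_mono mult_left_mono order_refl) (auto simp: sq_integral_minus_commute[of f])
      finally show ?thesis .
    qed
    have p: "(\<lambda>n. ennreal (a * (1 / 4) ^ n)) \<longlonglongrightarrow> ennreal (a * 0)" for a :: real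
      by (intro tendsto_intros LIMSEQ_power_zero) auto
    have "?b \<longlonglongrightarrow> 2 * (ennreal C * (2 * 0 + 2 * ennreal (1 * 0))) + 2 * ennreal ((C * 4) * 0)"
      using p[of 1] by (intro tendsto_add ennreal_tendsto_cmult lim p) auto
    hence "?b \<longlonglongrightarrow> 0" by simp
    thus "(\<lambda>n. sq_integral (\<lambda>\<xi>. mfrft_L1 \<alpha> lam (h n) \<xi> - g \<xi>)) \<longlonglongrightarrow> 0"
      by (rule tendsto_sandwich[rotated 3]) (use le in auto)
  qed
  thus ?thesis
    unfolding mfrft_def by (rule someI[where P="is_mfrft_extension \<alpha> lam f"])
qed

text \<open>Besides measurability, this is all that is used about the extended transform in what follows. It
  compares with an explicit integral transform, so linearity of the extension never has to be
  established; taking \<open>p = f\<close> shows that both transforms agree almost everywhere for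
  integrable \<open>f\<close>.\<close>

lemma mfrft_approximation:
  fixes \<alpha> :: "real ^ 'n"
  assumes C: "0 \<le> C" "\<And>h. integrable lebesgue h \<Longrightarrow> sq_integral (mfrft_L1 \<alpha> lam h) \<le> ennreal C * sq_integral h"
    and f: "f \<in> L2_space" and p: "integrable lebesgue p" "p \<in> L2_space"
  shows "sq_integral (\<lambda>\<xi>. mfrft_L1 \<alpha> lam p \<xi> - mfrft \<alpha> lam f \<xi>) \<le> ennreal (4 * C) * sq_integral (\<lambda>x. p x - f x)"
proof -
  let ?g = "mfrft \<alpha> lam f"
  note ext = is_mfrft_extension_mfrft[OF C f]
  hence g [measurable]: "?g \<in> borel_measurable lebesgue"
    by (auto simp: is_mfrft_extension_def L2_space_iff)
  have [measurable]: "f \<in> borel_measurable lebesgue" "p \<in> borel_measurable lebesgue"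
    using f p by (auto simp: L2_space_iff)
  have F_meas: "mfrft_L1 \<alpha> lam h \<in> borel_measurable lebesgue" if "integrable lebesgue h" for h
    using that by (intro lebesgue_measurable_if_borel borel_measurable_mfrft_L1)
  have "\<forall>n. \<exists>p. integrable lebesgue p \<and> p \<in> L2_space \<and> sq_integral (\<lambda>x. p x - f x) < ennreal ((1 / 4) ^ n)"
    using L1_L2_dense[OF f] by (metis zero_less_power zero_less_divide_1_iff zero_less_numeral)
  then obtain t where t: "\<And>n. integrable lebesgue (t n)" "\<And>n. t n \<in> L2_space"
    "\<And>n. sq_integral (\<lambda>x. t n x - f x) < ennreal ((1 / 4) ^ n)"
    by metis
  have [measurable]: "t n \<in> borel_measurable lebesgue" for n
    using t(1) by auto
  have z: "(\<lambda>n. ennreal ((1 / 4) ^ n)) \<longlonglongrightarrow> ennreal 0"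
    by (intro tendsto_intros LIMSEQ_power_zero) auto
  have tf: "(\<lambda>n. sq_integral (\<lambda>x. t n x - f x)) \<longlonglongrightarrow> 0"
    by (rule tendsto_sandwich[of "\<lambda>_. 0", OF _ _ _ z[simplified]])
       (use t(3) in \<open>auto intro!: always_eventually less_imp_le\<close>)
  hence Ft: "(\<lambda>n. sq_integral (\<lambda>\<xi>. mfrft_L1 \<alpha> lam (t n) \<xi> - ?g \<xi>)) \<longlonglongrightarrow> 0"
    using ext t by (auto simp: is_mfrft_extension_def L2_enorm_tendsto_0_iff)
  let ?b = "\<lambda>n. 2 * (ennreal C * (2 * sq_integral (\<lambda>x. p x - f x) + 2 * sq_integral (\<lambda>x. t n x - f x)))
      + 2 * sq_integral (\<lambda>\<xi>. mfrft_L1 \<alpha> lam (t n) \<xi> - ?g \<xi>)"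
  have le: "sq_integral (\<lambda>\<xi>. mfrft_L1 \<alpha> lam p \<xi> - ?g \<xi>) \<le> ?b n" for n
  proof -
    have "sq_integral (\<lambda>\<xi>. mfrft_L1 \<alpha> lam p \<xi> - ?g \<xi>)
        \<le> 2 * sq_integral (\<lambda>\<xi>. mfrft_L1 \<alpha> lam p \<xi> - mfrft_L1 \<alpha> lam (t n) \<xi>)
          + 2 * sq_integral (\<lambda>\<xi>. mfrft_L1 \<alpha> lam (t n) \<xi> - ?g \<xi>)"
      using p t by (intro sq_integral_triangle F_meas g) auto
    also have "sq_integral (\<lambda>\<xi>. mfrft_L1 \<alpha> lam p \<xi> - mfrft_L1 \<alpha> lam (t n) \<xi>) \<le> ennreal C * sq_integral (\<lambda>x. p x - t n x)"
      using C(2)[of "\<lambda>x. p x - t n x"] p t by (simp add: mfrft_L1_diff)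
    also have "sq_integral (\<lambda>x. p x - t n x) \<le> 2 * sq_integral (\<lambda>x. p x - f x) + 2 * sq_integral (\<lambda>x. f x - t n x)"
      by (intro sq_integral_triangle) measurable
    finally show ?thesis
      by (simp add: sq_integral_minus_commute[of f] mult_left_mono)
  qed
  have "?b \<longlonglongrightarrow> 2 * (ennreal C * (2 * sq_integral (\<lambda>x. p x - f x) + 2 * 0)) + 2 * 0"
    by (intro tendsto_add ennreal_tendsto_cmult tf Ft tendsto_const) auto
  hence "sq_integral (\<lambda>\<xi>. mfrft_L1 \<alpha> lam p \<xi> - ?g \<xi>) \<le> 2 * (ennreal C * (2 * sq_integral (\<lambda>x. p x - f x) + 2 * 0)) + 2 * 0"
    by (rule LIMSEQ_le_const) (use le in auto)
  also have "\<dots> = ennreal (4 * C) * sq_integral (\<lambda>x. p x - f x)"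
    using C(1) by (simp add: ennreal_mult' mult_ac)
  finally show ?thesis .
qed

section \<open>Integrals of powers of the norm\<close>

lemma term_le_suminf:
  fixes t :: "nat \<Rightarrow> ennreal"
  shows "t j \<le> (\<Sum>i. t i)"
  using sum_le_suminf[of t "{j}"] by simp

text \<open>Cover \<open>S\<close> by annuli with radii \<open>a j \<le> b j\<close>. On each annulus the power is at most
  \<open>a j powr (- s)\<close> and the volume is at most that of the ball of radius \<open>b j\<close>, so the integral is
  dominated by a geometric series. The origin, where the power takes the value \<open>0\<close>, does not
  have to be covered.\<close>

lemma dyadic_nn_integral_bound:
  fixes S :: "'a::euclidean_space set"
  assumes a: "\<And>j. 0 < a j" and cover: "\<And>x. x \<in> S \<Longrightarrow> x \<noteq> 0 \<Longrightarrow> \<exists>j::nat. a j \<le> norm x \<and> norm x \<le> b j"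
    and s: "0 \<le> s" and q: "0 \<le> q" "q < 1" and K: "0 \<le> K"
    and terms: "\<And>j. a j powr (- s) * b j ^ DIM('a) = K * q ^ j" and b: "\<And>j. 0 \<le> b j"
  shows "(\<integral>\<^sup>+x. indicator S x * ennreal (norm x powr (- s)) \<partial>lebesgue)
      \<le> ennreal (unit_ball_vol (real DIM('a)) / (1 - q) * K)"
proof -
  let ?v = "unit_ball_vol (real DIM('a))"
  have "(\<integral>\<^sup>+x. indicator S x * ennreal (norm x powr (- s)) \<partial>lebesgue)
      \<le> (\<integral>\<^sup>+x. (\<Sum>j. ennreal (a j powr (- s)) * indicator (cball (0::'a) (b j)) x) \<partial>lebesgue)"
  proof (rule nn_integral_mono)
    fix x :: 'a
    show "indicator S x * ennreal (norm x powr (- s)) \<le> (\<Sum>j. ennreal (a j powr (- s)) * indicator (cball 0 (b j)) x)"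
    proof (cases "x \<in> S \<and> x \<noteq> 0")
      case True
      then obtain j where j: "a j \<le> norm x" "norm x \<le> b j"
        using cover by blast
      have "indicator S x * ennreal (norm x powr (- s)) \<le> ennreal (a j powr (- s)) * indicator (cball 0 (b j)) x"
        using True j a[of j] s by (auto intro!: ennreal_leI powr_mono2')
      also have "\<dots> \<le> (\<Sum>j. ennreal (a j powr (- s)) * indicator (cball 0 (b j)) x)"
        by (rule term_le_suminf)
      finally show ?thesis .
    next
      case False
      hence "indicator S x * ennreal (norm x powr (- s)) = 0"
        by (cases "x \<in> S") simp_all
      thus ?thesis by (simp only: zero_le)
    qed
  qed
  also have "\<dots> = (\<Sum>j. ennreal (a j powr (- s)) * emeasure lebesgue (cball (0::'a) (b j)))"
  proof (subst nn_integral_suminf)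
    show "(\<lambda>x. ennreal (a j powr (- s)) * indicator (cball (0::'a) (b j)) x) \<in> borel_measurable lebesgue" for j
      by (intro borel_measurable_times_ennreal borel_measurable_const borel_measurable_indicator) simp
    show "(\<Sum>j. \<integral>\<^sup>+x. ennreal (a j powr (- s)) * indicator (cball (0::'a) (b j)) x \<partial>lebesgue)
       = (\<Sum>j. ennreal (a j powr (- s)) * emeasure lebesgue (cball (0::'a) (b j)))"
      by (intro suminf_cong nn_integral_cmult_indicator) simp
  qed
  also have "\<dots> = (\<Sum>j. ennreal (?v * K * q ^ j))"
  proof (rule suminf_cong)
    fix j
    have "ennreal (a j powr (- s)) * emeasure lebesgue (cball (0::'a) (b j)) = ennreal (?v * (a j powr (- s) * b j ^ DIM('a)))"
      using b[of j] by (simp add: emeasure_cball ennreal_mult'[symmetric] mult_ac)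
    thus "ennreal (a j powr (- s)) * emeasure lebesgue (cball (0::'a) (b j)) = ennreal (?v * K * q ^ j)"
      unfolding terms by (simp add: mult_ac)
  qed
  also have "\<dots> = ennreal (\<Sum>j. ?v * K * q ^ j)"
    using q K by (intro suminf_ennreal2 summable_mult summable_geometric) auto
  also have "(\<Sum>j. ?v * K * q ^ j) = ?v / (1 - q) * K"
    using q by (simp add: suminf_mult suminf_geometric summable_geometric)
  finally show ?thesis .
qed

lemma dyadic_bracket:
  fixes y :: real
  assumes "1 \<le> y"
  obtains j :: nat where "2 ^ j \<le> y" "y \<le> 2 ^ Suc j"
proof -
  have ex: "\<exists>n. y < 2 ^ n" by (rule real_arch_pow) simp
  define n where "n = (LEAST n. y < 2 ^ n)"
  have n: "y < 2 ^ n" unfolding n_def by (rule LeastI_ex[OF ex])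
  with assms obtain j where j: "n = Suc j" by (cases n) auto
  have "\<not> y < 2 ^ j" using not_less_Least[of j "\<lambda>n. y < 2 ^ n"] j by (simp add: n_def)
  with n j show thesis by (intro that[of j]) auto
qed

lemma nn_integral_norm_powr_cball:
  fixes r s :: real
  assumes r: "0 < r" and s: "0 \<le> s" "s < real DIM('a::euclidean_space)"
  shows "(\<integral>\<^sup>+x. indicator (cball (0::'a) r) x * ennreal (norm x powr (- s)) \<partial>lebesgue)
     \<le> ennreal (unit_ball_vol (real DIM('a)) / (1 - 2 powr (s - real DIM('a))) * (2 powr s * r powr (real DIM('a) - s)))"
proof (rule dyadic_nn_integral_bound[where a="\<lambda>j. r / 2 ^ Suc j" and b="\<lambda>j. r / 2 ^ j"])
  show "2 powr (s - real DIM('a)) < 1"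
    using s powr_less_mono[of "s - real DIM('a)" 0 2] by simp
  show "\<exists>j. r / 2 ^ Suc j \<le> norm x \<and> norm x \<le> r / 2 ^ j" if "x \<in> cball 0 r" "x \<noteq> 0" for x :: 'a
  proof -
    from that have "1 \<le> r / norm x" by simp
    then obtain j :: nat where "2 ^ j \<le> r / norm x" "r / norm x \<le> 2 ^ Suc j"
      by (rule dyadic_bracket)
    with that have "r / 2 ^ Suc j \<le> norm x \<and> norm x \<le> r / 2 ^ j"
      by (simp add: field_simps)
    thus ?thesis by blast
  qed
  fix j :: nat
  have "(r / 2 ^ Suc j) powr (- s) = exp (- s * (ln r - real (Suc j) * ln 2))"
    using r by (simp add: powr_def ln_div ln_mult ln_realpow algebra_simps)
  moreover have "(r / 2 ^ j) ^ DIM('a) = exp (real DIM('a) * (ln r - real j * ln 2))"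
    using r by (subst powr_realpow[symmetric]) (auto simp: powr_def ln_div ln_realpow)
  ultimately have "(r / 2 ^ Suc j) powr (- s) * (r / 2 ^ j) ^ DIM('a)
      = exp (- s * (ln r - real (Suc j) * ln 2) + real DIM('a) * (ln r - real j * ln 2))"
    by (simp only: exp_add)
  also have "- s * (ln r - real (Suc j) * ln 2) + real DIM('a) * (ln r - real j * ln 2)
      = s * ln 2 + (real DIM('a) - s) * ln r + real j * ((s - real DIM('a)) * ln 2)"
    by (simp add: algebra_simps)
  also have "exp \<dots> = 2 powr s * r powr (real DIM('a) - s) * (2 powr (s - real DIM('a))) ^ j"
    using r by (simp add: powr_def exp_add exp_of_nat_mult)
  finally show "(r / 2 ^ Suc j) powr (- s) * (r / 2 ^ j) ^ DIM('a)
      = 2 powr s * r powr (real DIM('a) - s) * (2 powr (s - real DIM('a))) ^ j" .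
  show "0 < r / 2 ^ Suc j" "0 \<le> r / 2 ^ j" using r by simp_all
  show "0 \<le> s" by (fact s(1))
  show "0 \<le> 2 powr (s - real DIM('a))" "0 \<le> 2 powr s * r powr (real DIM('a) - s)" by simp_all
qed

lemma nn_integral_norm_powr_outside:
  fixes r s :: real
  assumes r: "0 < r" and s: "real DIM('a::euclidean_space) < s"
  shows "(\<integral>\<^sup>+x. indicator (- cball (0::'a) r) x * ennreal (norm x powr (- s)) \<partial>lebesgue)
     \<le> ennreal (unit_ball_vol (real DIM('a)) / (1 - 2 powr (real DIM('a) - s)) * (2 powr real DIM('a) * r powr (real DIM('a) - s)))"
proof (rule dyadic_nn_integral_bound[where a="\<lambda>j. r * 2 ^ j" and b="\<lambda>j. r * 2 ^ Suc j"])
  show "2 powr (real DIM('a) - s) < 1"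
    using s powr_less_mono[of "real DIM('a) - s" 0 2] by simp
  show "\<exists>j. r * 2 ^ j \<le> norm x \<and> norm x \<le> r * 2 ^ Suc j" if "x \<in> - cball 0 r" "x \<noteq> 0" for x :: 'a
  proof -
    from that r have "1 \<le> norm x / r" by simp
    then obtain j :: nat where "2 ^ j \<le> norm x / r" "norm x / r \<le> 2 ^ Suc j"
      by (rule dyadic_bracket)
    with r have "r * 2 ^ j \<le> norm x \<and> norm x \<le> r * 2 ^ Suc j"
      by (simp add: field_simps)
    thus ?thesis by blast
  qed
  fix j :: nat
  have "(r * 2 ^ j) powr (- s) = exp (- s * (ln r + real j * ln 2))"
    using r by (simp add: powr_def ln_mult ln_realpow algebra_simps)
  moreover have "(r * 2 ^ Suc j) ^ DIM('a) = exp (real DIM('a) * (ln r + real (Suc j) * ln 2))"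
    using r by (subst powr_realpow[symmetric]) (auto simp: powr_def ln_mult ln_realpow algebra_simps)
  ultimately have "(r * 2 ^ j) powr (- s) * (r * 2 ^ Suc j) ^ DIM('a)
      = exp (- s * (ln r + real j * ln 2) + real DIM('a) * (ln r + real (Suc j) * ln 2))"
    by (simp only: exp_add)
  also have "- s * (ln r + real j * ln 2) + real DIM('a) * (ln r + real (Suc j) * ln 2)
      = real DIM('a) * ln 2 + (real DIM('a) - s) * ln r + real j * ((real DIM('a) - s) * ln 2)"
    by (simp add: algebra_simps)
  also have "exp \<dots> = 2 powr real DIM('a) * r powr (real DIM('a) - s) * (2 powr (real DIM('a) - s)) ^ j"
    using r by (simp add: powr_def exp_add exp_of_nat_mult)
  finally show "(r * 2 ^ j) powr (- s) * (r * 2 ^ Suc j) ^ DIM('a)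
      = 2 powr real DIM('a) * r powr (real DIM('a) - s) * (2 powr (real DIM('a) - s)) ^ j" .
  show "0 \<le> s" using s of_nat_0_le_iff[of "DIM('a)"] by linarith
  show "0 < r * 2 ^ j" "0 \<le> r * 2 ^ Suc j" using r by simp_all
  show "0 \<le> 2 powr (real DIM('a) - s)" "0 \<le> 2 powr real DIM('a) * r powr (real DIM('a) - s)" by simp_all
qed

section \<open>Bounds by weighted norms\<close>

text \<open>Split \<open>|f| = |x| powr (- \<theta>) * (|x| powr \<theta> * |f|)\<close>, which holds away from the origin.\<close>

lemma weighted_Cauchy_Schwarz:
  fixes f :: "'a::euclidean_space \<Rightarrow> complex"
  assumes [measurable]: "f \<in> borel_measurable lebesgue" "S \<in> sets lebesgue"
  shows "(\<integral>\<^sup>+x. indicator S x * ennreal (cmod (f x)) \<partial>lebesgue)\<^sup>2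
      \<le> (\<integral>\<^sup>+x. indicator S x * ennreal (norm x powr (- (2 * \<theta>))) \<partial>lebesgue) * sq_integral (norm_weight \<theta> f)"
proof -
  have [measurable]: "(\<lambda>x::'a. norm x powr a) \<in> borel_measurable lebesgue" for a
    by (rule lebesgue_measurable_if_borel) measurable
  have "AE x in lebesgue. x \<noteq> (0::'a)"
    by (rule AE_completion) (rule AE_lborel_singleton)
  hence "(\<integral>\<^sup>+x. indicator S x * ennreal (cmod (f x)) \<partial>lebesgue)
      = (\<integral>\<^sup>+x. (indicator S x * ennreal (norm x powr (- \<theta>))) * ennreal (cmod (norm_weight \<theta> f x)) \<partial>lebesgue)"
    by (intro nn_integral_cong_AE, eventually_elim)
       (auto simp: indicator_def norm_weight_def norm_mult powr_minus field_simps simp flip: ennreal_mult')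
  also have "\<dots>\<^sup>2 \<le> (\<integral>\<^sup>+x. (indicator S x * ennreal (norm x powr (- \<theta>)))\<^sup>2 \<partial>lebesgue)
      * (\<integral>\<^sup>+x. (ennreal (cmod (norm_weight \<theta> f x)))\<^sup>2 \<partial>lebesgue)"
    unfolding norm_weight_def by (rule Cauchy_Schwarz_nn_integral) measurable
  also have "(\<integral>\<^sup>+x. (ennreal (cmod (norm_weight \<theta> f x)))\<^sup>2 \<partial>lebesgue) = sq_integral (norm_weight \<theta> f)"
    by (simp add: sq_integral_def ennreal_power)
  also have "(\<integral>\<^sup>+x. (indicator S x * ennreal (norm x powr (- \<theta>)))\<^sup>2 \<partial>lebesgue)
      = (\<integral>\<^sup>+x. indicator S x * ennreal (norm x powr (- (2 * \<theta>))) \<partial>lebesgue)"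
  proof -
    have "(norm x powr (- \<theta>))\<^sup>2 = norm x powr (- (2 * \<theta>))" for x :: 'a
      by (simp add: power2_eq_square flip: powr_add)
    thus ?thesis
      by (intro nn_integral_cong) (auto simp: indicator_def ennreal_power)
  qed
  finally show ?thesis .
qed

lemma Cauchy_Schwarz_on_set:
  fixes f :: "'a::euclidean_space \<Rightarrow> complex"
  assumes [measurable]: "f \<in> borel_measurable lebesgue" "S \<in> sets lebesgue"
  shows "(\<integral>\<^sup>+x. indicator S x * ennreal (cmod (f x)) \<partial>lebesgue)\<^sup>2 \<le> emeasure lebesgue S * sq_integral f"
proof -
  have "(\<integral>\<^sup>+x. indicator S x * ennreal (cmod (f x)) \<partial>lebesgue)\<^sup>2
     \<le> (\<integral>\<^sup>+x. (indicator S x)\<^sup>2 \<partial>lebesgue) * (\<integral>\<^sup>+x. (ennreal (cmod (f x)))\<^sup>2 \<partial>lebesgue)"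
    by (rule Cauchy_Schwarz_nn_integral) measurable
  also have "(\<integral>\<^sup>+x. (indicator S x :: ennreal)\<^sup>2 \<partial>lebesgue) = emeasure lebesgue S"
  proof -
    have "(indicator S x :: ennreal)\<^sup>2 = indicator S x" for x
      by (simp add: indicator_def)
    thus ?thesis by simp
  qed
  finally show ?thesis
    by (simp add: sq_integral_def ennreal_power)
qed

lemma sq_integral_outside_cball:
  fixes f :: "'a::euclidean_space \<Rightarrow> complex"
  assumes [measurable]: "f \<in> borel_measurable lebesgue" and r: "0 < r" and \<theta>: "0 \<le> \<theta>"
  shows "sq_integral (\<lambda>x. indicator (cball 0 r) x * f x - f x) \<le> ennreal (r powr (- (2 * \<theta>))) * sq_integral (norm_weight \<theta> f)"
proof -
  have [measurable]: "(\<lambda>x::'a. norm x powr a) \<in> borel_measurable lebesgue" for a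
    by (rule lebesgue_measurable_if_borel) measurable
  have "sq_integral (\<lambda>x. indicator (cball 0 r) x * f x - f x)
     \<le> (\<integral>\<^sup>+x. ennreal (r powr (- (2 * \<theta>))) * ennreal ((cmod (norm_weight \<theta> f x))\<^sup>2) \<partial>lebesgue)"
    unfolding sq_integral_def
  proof (rule nn_integral_mono)
    fix x :: 'a
    have "(cmod (f x))\<^sup>2 \<le> r powr (- (2 * \<theta>)) * (cmod (norm_weight \<theta> f x))\<^sup>2" if "r < norm x"
    proof -
      have "1 \<le> (norm x / r) powr (2 * \<theta>)"
        using that r \<theta> by (intro ge_one_powr_ge_zero) auto
      also have "\<dots> = r powr (- (2 * \<theta>)) * (norm x powr \<theta>)\<^sup>2"
        using that r by (simp add: powr_divide powr_minus power2_eq_square field_simps flip: powr_add)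
      finally have "(cmod (f x))\<^sup>2 * 1 \<le> (cmod (f x))\<^sup>2 * (r powr (- (2 * \<theta>)) * (norm x powr \<theta>)\<^sup>2)"
        by (intro mult_left_mono) auto
      thus ?thesis
        by (simp add: norm_weight_def norm_mult power_mult_distrib mult_ac)
    qed
    thus "ennreal ((cmod (indicator (cball 0 r) x * f x - f x))\<^sup>2)
       \<le> ennreal (r powr (- (2 * \<theta>))) * ennreal ((cmod (norm_weight \<theta> f x))\<^sup>2)"
      by (auto simp: indicator_def ennreal_mult'[symmetric] intro!: ennreal_leI)
  qed
  also have "\<dots> = ennreal (r powr (- (2 * \<theta>))) * sq_integral (norm_weight \<theta> f)"
    unfolding sq_integral_def norm_weight_def by (rule nn_integral_cmult) measurable
  finally show ?thesis .
qed

section \<open>Local uncertainty inequalities\<close>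

lemma sq_integral_eq_0_if_weighted:
  fixes f :: "'a::euclidean_space \<Rightarrow> complex"
  assumes [measurable]: "f \<in> borel_measurable lebesgue" and "sq_integral (norm_weight \<theta> f) = 0"
  shows "sq_integral f = 0"
proof -
  have [measurable]: "(\<lambda>x::'a. norm x powr a) \<in> borel_measurable lebesgue" for a
    by (rule lebesgue_measurable_if_borel) measurable
  have "AE x in lebesgue. ennreal ((cmod (norm_weight \<theta> f x))\<^sup>2) = 0"
    using assms(2) unfolding sq_integral_def norm_weight_def
    by (subst (asm) nn_integral_0_iff_AE) auto
  moreover have "AE x in lebesgue. x \<noteq> (0::'a)"
    by (rule AE_completion) (rule AE_lborel_singleton)
  ultimately have "AE x in lebesgue. ennreal ((cmod (f x))\<^sup>2) = 0"
    by eventually_elim (auto simp: norm_weight_def)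
  thus ?thesis
    unfolding sq_integral_def by (subst nn_integral_0_iff_AE) auto
qed

lemma set_sq_integral_approximation:
  fixes F g :: "'a::euclidean_space \<Rightarrow> complex"
  assumes [measurable]: "F \<in> borel_measurable lebesgue" "g \<in> borel_measurable lebesgue" "K \<in> sets lebesgue"
    and sup: "\<And>\<eta>. ennreal (cmod (F \<eta>)) \<le> B"
  shows "(\<integral>\<^sup>+\<eta>\<in>K. ennreal ((cmod (g \<eta>))\<^sup>2) \<partial>lebesgue)
     \<le> 2 * (emeasure lebesgue K * B\<^sup>2) + 2 * sq_integral (\<lambda>\<eta>. F \<eta> - g \<eta>)"
proof -
  have "(\<integral>\<^sup>+\<eta>\<in>K. ennreal ((cmod (g \<eta>))\<^sup>2) \<partial>lebesgue)
     = sq_integral (\<lambda>\<eta>. indicator K \<eta> * g \<eta> - 0)"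
    unfolding sq_integral_def by (intro nn_integral_cong) (auto simp: indicator_def)
  also have "\<dots> \<le> 2 * sq_integral (\<lambda>\<eta>. indicator K \<eta> * g \<eta> - indicator K \<eta> * F \<eta>)
       + 2 * sq_integral (\<lambda>\<eta>. indicator K \<eta> * F \<eta> - 0)"
    by (rule sq_integral_triangle) measurable
  also have "\<dots> \<le> 2 * sq_integral (\<lambda>\<eta>. F \<eta> - g \<eta>) + 2 * (B\<^sup>2 * emeasure lebesgue K)"
  proof (intro add_mono mult_left_mono)
    show "sq_integral (\<lambda>\<eta>. indicator K \<eta> * g \<eta> - indicator K \<eta> * F \<eta>) \<le> sq_integral (\<lambda>\<eta>. F \<eta> - g \<eta>)"
      unfolding sq_integral_def
      by (intro nn_integral_mono) (auto simp: indicator_def norm_minus_commute)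
    have "sq_integral (\<lambda>\<eta>. indicator K \<eta> * F \<eta> - 0) \<le> (\<integral>\<^sup>+\<eta>. B\<^sup>2 * indicator K \<eta> \<partial>lebesgue)"
      unfolding sq_integral_def
    proof (rule nn_integral_mono)
      fix \<eta>
      have "ennreal ((cmod (F \<eta>))\<^sup>2) \<le> B\<^sup>2"
        using power_mono[OF sup[of \<eta>], of 2] by (simp add: ennreal_power)
      thus "ennreal ((cmod (indicator K \<eta> * F \<eta> - 0))\<^sup>2) \<le> B\<^sup>2 * indicator K \<eta>"
        by (auto simp: indicator_def)
    qed
    thus "sq_integral (\<lambda>\<eta>. indicator K \<eta> * F \<eta> - 0) \<le> B\<^sup>2 * emeasure lebesgue K"
      by (simp add: nn_integral_cmult_indicator)
  qed auto
  finally show ?thesis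
    by (simp add: add.commute mult.commute)
qed

lemma ennreal_sum_power2_le: "(x + y)\<^sup>2 \<le> 2 * x\<^sup>2 + 2 * (y\<^sup>2 :: ennreal)"
proof (cases "x = top \<or> y = top")
  case True
  thus ?thesis
    by (auto simp: top_power_ennreal ennreal_mult_top)
next
  case False
  then obtain a b where ab: "x = ennreal a" "y = ennreal b" "0 \<le> a" "0 \<le> b"
    by (metis ennreal_cases)
  have "(a + b)\<^sup>2 \<le> 2 * a\<^sup>2 + 2 * b\<^sup>2"
    using sum_squares_bound[of a b] by (simp add: power2_sum)
  hence "ennreal ((a + b)\<^sup>2) \<le> ennreal (2 * a\<^sup>2 + 2 * b\<^sup>2)"
    by (rule ennreal_leI)
  moreover have "ennreal ((a + b)\<^sup>2) = (ennreal (a + b))\<^sup>2"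
    using ab by (simp add: ennreal_power del: ennreal_plus)
  moreover have "ennreal (a + b) = x + y"
    using ab by simp
  moreover have "ennreal (2 * a\<^sup>2 + 2 * b\<^sup>2) = 2 * x\<^sup>2 + 2 * y\<^sup>2"
    using ab by (simp add: ennreal_power ennreal_mult')
  ultimately show ?thesis by simp
qed

context
  fixes \<alpha> :: "real ^ 'n" and lam C :: real
  assumes C: "0 \<le> C" "\<And>h. integrable lebesgue h \<Longrightarrow> sq_integral (mfrft_L1 \<alpha> lam h) \<le> ennreal C * sq_integral h"
begin

text \<open>An integrable part \<open>p\<close> of \<open>f\<close> has a bounded transform, whose contribution is controlled by the
  measure of \<open>K\<close>; the transform of the rest is controlled by its square integral over the whole
  space.\<close>

lemma mfrft_set_bound:
  assumes f: "f \<in> L2_space" and p: "integrable lebesgue p" "p \<in> L2_space" and K: "K \<in> sets lebesgue"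
  shows "(\<integral>\<^sup>+\<eta>\<in>K. ennreal ((cmod (mfrft \<alpha> lam f \<eta>))\<^sup>2) \<partial>lebesgue)
     \<le> ennreal (2 * (kernel_bound \<alpha>)\<^sup>2) * emeasure lebesgue K * (\<integral>\<^sup>+x. ennreal (cmod (p x)) \<partial>lebesgue)\<^sup>2
       + ennreal (8 * C) * sq_integral (\<lambda>x. p x - f x)"
proof -
  have k0: "0 \<le> kernel_bound \<alpha>" by (simp add: kernel_bound_def)
  have "mfrft \<alpha> lam f \<in> borel_measurable lebesgue"
    using is_mfrft_extension_mfrft[OF C f] by (auto simp: is_mfrft_extension_def L2_space_iff)
  hence "(\<integral>\<^sup>+\<eta>\<in>K. ennreal ((cmod (mfrft \<alpha> lam f \<eta>))\<^sup>2) \<partial>lebesgue)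
     \<le> 2 * (emeasure lebesgue K * (ennreal (kernel_bound \<alpha>) * (\<integral>\<^sup>+x. ennreal (cmod (p x)) \<partial>lebesgue))\<^sup>2)
       + 2 * sq_integral (\<lambda>\<eta>. mfrft_L1 \<alpha> lam p \<eta> - mfrft \<alpha> lam f \<eta>)"
    using p K
    by (intro set_sq_integral_approximation norm_mfrft_L1 lebesgue_measurable_if_borel[OF borel_measurable_mfrft_L1]) auto
  also have "\<dots> \<le> 2 * (emeasure lebesgue K * (ennreal (kernel_bound \<alpha>) * (\<integral>\<^sup>+x. ennreal (cmod (p x)) \<partial>lebesgue))\<^sup>2)
       + 2 * (ennreal (4 * C) * sq_integral (\<lambda>x. p x - f x))"
    by (intro add_mono order_refl mult_left_mono mfrft_approximation[OF C f p]) auto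
  also have "\<dots> = ennreal (2 * (kernel_bound \<alpha>)\<^sup>2) * emeasure lebesgue K * (\<integral>\<^sup>+x. ennreal (cmod (p x)) \<partial>lebesgue)\<^sup>2
       + ennreal (8 * C) * sq_integral (\<lambda>x. p x - f x)"
    using k0 C(1) by (simp add: power_mult_distrib ennreal_power[symmetric] ennreal_mult' mult_ac)
  finally show ?thesis .
qed

text \<open>Take for \<open>p\<close> the restriction of \<open>f\<close> to the ball of radius \<open>r\<close>. For \<open>2 \<theta> < N\<close> the power
  \<open>|x| powr (- 2 \<theta>)\<close> is integrable on this ball, so \<open>p\<close> contributes \<open>|K| r powr (N - 2 \<theta>)\<close>, and the
  rest contributes \<open>r powr (- 2 \<theta>)\<close>. Both are equal when \<open>r ^ N = 1 / |K|\<close>.\<close>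

lemma mfrft_local_uncertainty_small:
  assumes \<theta>: "0 < \<theta>" "\<theta> < real CARD('n) / 2"
  shows "\<exists>A>0. \<forall>K\<in>sets lebesgue. \<forall>f\<in>L2_space.
     (\<integral>\<^sup>+\<eta>\<in>K. ennreal ((cmod (mfrft \<alpha> lam f \<eta>))\<^sup>2) \<partial>lebesgue)
      \<le> ennreal A * epowr (emeasure lebesgue K) (2 * \<theta> / real CARD('n)) * sq_integral (norm_weight \<theta> f)"
proof -
  define N where "N = real CARD('n)"
  define M where "M = unit_ball_vol N / (1 - 2 powr (2 * \<theta> - N)) * 2 powr (2 * \<theta>)"
  have N0: "N > 0" by (simp add: N_def)
  have "2 powr (2 * \<theta> - N) < 1"
    using \<theta> powr_less_mono[of "2 * \<theta> - N" 0 2] by (simp add: N_def)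
  hence M0: "M \<ge> 0"
    unfolding M_def N_def by (intro mult_nonneg_nonneg divide_nonneg_nonneg) auto
  define A where "A = 2 * (kernel_bound \<alpha>)\<^sup>2 * M + 8 * C + 1"
  have A0: "A > 0"
    using M0 C(1) by (simp add: A_def add_nonneg_pos)
  have ineq: "(\<integral>\<^sup>+\<eta>\<in>K. ennreal ((cmod (mfrft \<alpha> lam f \<eta>))\<^sup>2) \<partial>lebesgue)
     \<le> ennreal (2 * (kernel_bound \<alpha>)\<^sup>2) * emeasure lebesgue K * (ennreal (M * r powr (N - 2 * \<theta>)) * sq_integral (norm_weight \<theta> f))
       + ennreal (8 * C) * (ennreal (r powr (- (2 * \<theta>))) * sq_integral (norm_weight \<theta> f))"
    if K: "K \<in> sets lebesgue" and f: "f \<in> L2_space" and r: "0 < r" for K f r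
  proof -
    have fm: "f \<in> borel_measurable lebesgue" using f by (simp add: L2_space_iff)
    let ?p = "\<lambda>x. indicator (cball 0 r) x * f x"
    have "(\<integral>\<^sup>+x. ennreal (cmod (?p x)) \<partial>lebesgue) = (\<integral>\<^sup>+x. indicator (cball 0 r) x * ennreal (cmod (f x)) \<partial>lebesgue)"
      by (intro nn_integral_cong) (auto simp: indicator_def)
    hence "(\<integral>\<^sup>+x. ennreal (cmod (?p x)) \<partial>lebesgue)\<^sup>2
        \<le> (\<integral>\<^sup>+x. indicator (cball (0::real^'n) r) x * ennreal (norm x powr (- (2 * \<theta>))) \<partial>lebesgue) * sq_integral (norm_weight \<theta> f)"
      using weighted_Cauchy_Schwarz[OF fm, of "cball 0 r" \<theta>] by simp
    also have "\<dots> \<le> ennreal (M * r powr (N - 2 * \<theta>)) * sq_integral (norm_weight \<theta> f)"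
      using nn_integral_norm_powr_cball[OF r, of "2 * \<theta>", where 'a="real^'n"] \<theta>
      by (intro mult_right_mono) (auto simp: M_def N_def mult_ac)
    finally have L1: "(\<integral>\<^sup>+x. ennreal (cmod (?p x)) \<partial>lebesgue)\<^sup>2 \<le> ennreal (M * r powr (N - 2 * \<theta>)) * sq_integral (norm_weight \<theta> f)" .
    have "(\<integral>\<^sup>+\<eta>\<in>K. ennreal ((cmod (mfrft \<alpha> lam f \<eta>))\<^sup>2) \<partial>lebesgue)
     \<le> ennreal (2 * (kernel_bound \<alpha>)\<^sup>2) * emeasure lebesgue K * (\<integral>\<^sup>+x. ennreal (cmod (?p x)) \<partial>lebesgue)\<^sup>2
       + ennreal (8 * C) * sq_integral (\<lambda>x. ?p x - f x)"
      by (rule mfrft_set_bound[OF f L2_cball_integrable[OF f] L2_indicator[OF f] K]) auto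
    also have "\<dots> \<le> ennreal (2 * (kernel_bound \<alpha>)\<^sup>2) * emeasure lebesgue K * (ennreal (M * r powr (N - 2 * \<theta>)) * sq_integral (norm_weight \<theta> f))
       + ennreal (8 * C) * (ennreal (r powr (- (2 * \<theta>))) * sq_integral (norm_weight \<theta> f))"
      using \<theta> by (intro add_mono mult_left_mono L1 sq_integral_outside_cball[OF fm r]) auto
    finally show ?thesis .
  qed
  show ?thesis
  proof (intro exI[of _ A] conjI ballI A0)
    fix K :: "(real ^ 'n) set" and f :: "real ^ 'n \<Rightarrow> complex"
    assume K: "K \<in> sets lebesgue" and f: "f \<in> L2_space"
    let ?L = "\<integral>\<^sup>+\<eta>\<in>K. ennreal ((cmod (mfrft \<alpha> lam f \<eta>))\<^sup>2) \<partial>lebesgue"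
    let ?W = "sq_integral (norm_weight \<theta> f)"
    consider (W0) "?W = 0" | (top) "?W \<noteq> 0" "emeasure lebesgue K = top"
      | (null) "emeasure lebesgue K = 0"
      | (fin) m where "emeasure lebesgue K = ennreal m" "m > 0"
      by (cases "emeasure lebesgue K" rule: ennreal_cases) (force simp: less_le)+
    thus "?L \<le> ennreal A * epowr (emeasure lebesgue K) (2 * \<theta> / real CARD('n)) * ?W"
    proof cases
      case W0
      \<comment> \<open>any radius will do: both terms vanish, by \<open>\<infinity> * 0 = 0\<close> even if \<open>K\<close> has infinite measure\<close>
      thus ?thesis using ineq[OF K f, of 1] by simp
    next
      case top
      thus ?thesis using A0 by (simp add: epowr_def ennreal_mult_top ennreal_top_mult)
    next
      case null
      hence "AE \<eta> in lebesgue. \<eta> \<notin> K"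
        using K by (intro AE_not_in) auto
      hence "?L = (\<integral>\<^sup>+\<eta>. 0 \<partial>(lebesgue::(real^'n) measure))"
        by (intro nn_integral_cong_AE) (auto elim!: eventually_mono)
      thus ?thesis by simp
    next
      case fin
      let ?r = "m powr (- 1 / N)"
      have "?L \<le> ennreal (2 * (kernel_bound \<alpha>)\<^sup>2) * ennreal m * (ennreal (M * ?r powr (N - 2 * \<theta>)) * ?W)
         + ennreal (8 * C) * (ennreal (?r powr (- (2 * \<theta>))) * ?W)"
        using ineq[OF K f, of ?r] fin by simp
      also have "\<dots> = ennreal (2 * (kernel_bound \<alpha>)\<^sup>2 * m * (M * ?r powr (N - 2 * \<theta>)) + 8 * C * ?r powr (- (2 * \<theta>))) * ?W"
        using fin M0 C(1) by (simp add: ennreal_mult' ennreal_plus distrib_right mult.assoc)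
      also have "2 * (kernel_bound \<alpha>)\<^sup>2 * m * (M * ?r powr (N - 2 * \<theta>)) + 8 * C * ?r powr (- (2 * \<theta>))
          = (2 * (kernel_bound \<alpha>)\<^sup>2 * M + 8 * C) * m powr (2 * \<theta> / N)"
      proof -
        have "m * ?r powr (N - 2 * \<theta>) = m powr 1 * m powr (2 * \<theta> / N - 1)"
        proof -
          have "- 1 / N * (N - 2 * \<theta>) = 2 * \<theta> / N - 1"
            using N0 by (simp add: field_simps)
          thus ?thesis
            using fin by (simp only: powr_powr) simp
        qed
        also have "\<dots> = m powr (2 * \<theta> / N)"
          by (simp only: powr_add[symmetric]) simp
        finally have "m * ?r powr (N - 2 * \<theta>) = m powr (2 * \<theta> / N)" .
        moreover have "?r powr (- (2 * \<theta>)) = m powr (2 * \<theta> / N)"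
          by (simp add: powr_powr)
        ultimately show ?thesis
          by (simp add: algebra_simps)
      qed
      also have "ennreal \<dots> * ?W \<le> ennreal (A * m powr (2 * \<theta> / N)) * ?W"
        by (intro mult_right_mono ennreal_leI) (auto simp: A_def)
      also have "\<dots> = ennreal A * epowr (emeasure lebesgue K) (2 * \<theta> / real CARD('n)) * ?W"
        using fin A0 by (simp add: epowr_def N_def ennreal_mult')
      finally show ?thesis .
    qed
  qed
qed

text \<open>For \<open>2 \<theta> > N\<close> the power \<open>|x| powr (- 2 \<theta>)\<close> is integrable outside of balls, so \<open>f\<close> itself is
  integrable and one may take \<open>p = f\<close>. The square of its \<open>L\<^sup>1\<close> norm is at most a constant times
  \<open>r powr N * S + r powr (N - 2 \<theta>) * W\<close>, with \<open>S\<close> and \<open>W\<close> the unweighted and the weighted square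
  integral; \<open>r powr (2 \<theta>) = W / S\<close> balances the two terms.\<close>

lemma mfrft_local_uncertainty_large:
  assumes \<theta>: "real CARD('n) / 2 < \<theta>"
  shows "\<exists>A>0. \<forall>K\<in>sets lebesgue. \<forall>f\<in>L2_space.
     (\<integral>\<^sup>+\<eta>\<in>K. ennreal ((cmod (mfrft \<alpha> lam f \<eta>))\<^sup>2) \<partial>lebesgue)
      \<le> ennreal A * emeasure lebesgue K * epowr (L2_enorm f) (2 - real CARD('n) / \<theta>)
          * epowr (L2_enorm (norm_weight \<theta> f)) (real CARD('n) / \<theta>)"
proof -
  define N where "N = real CARD('n)"
  define v where "v = unit_ball_vol N"
  define M where "M = v / (1 - 2 powr (N - 2 * \<theta>)) * 2 powr N"
  have N0: "N > 0" by (simp add: N_def)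
  have \<theta>0: "\<theta> > 0" using \<theta> N0 by (simp add: N_def)
  have v0: "v \<ge> 0" by (simp add: v_def N_def)
  have "2 powr (N - 2 * \<theta>) < 1"
    using \<theta> powr_less_mono[of "N - 2 * \<theta>" 0 2] by (simp add: N_def)
  hence M0: "M \<ge> 0"
    using v0 unfolding M_def by (intro mult_nonneg_nonneg divide_nonneg_nonneg) auto
  define A where "A = 4 * (kernel_bound \<alpha>)\<^sup>2 * (v + M) + 1"
  have A0: "A > 0"
    using M0 v0 by (simp add: A_def add_nonneg_pos)
  have L1: "(\<integral>\<^sup>+x. ennreal (cmod (f x)) \<partial>lebesgue)\<^sup>2
      \<le> 2 * (ennreal (v * r powr N) * sq_integral f) + 2 * (ennreal (M * r powr (N - 2 * \<theta>)) * sq_integral (norm_weight \<theta> f))"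
    if fm: "f \<in> borel_measurable lebesgue" and r: "0 < r" for f :: "real ^ 'n \<Rightarrow> complex" and r
  proof -
    note [measurable] = fm
    let ?B = "cball 0 r :: (real ^ 'n) set"
    have B [measurable]: "?B \<in> sets lebesgue" by simp
    hence [measurable]: "- ?B \<in> sets lebesgue" by (simp add: Compl_in_sets_lebesgue)
    let ?I = "\<lambda>S. \<integral>\<^sup>+x. indicator S x * ennreal (cmod (f x)) \<partial>lebesgue"
    have "(\<integral>\<^sup>+x. ennreal (cmod (f x)) \<partial>lebesgue)
        = (\<integral>\<^sup>+x. indicator ?B x * ennreal (cmod (f x)) + indicator (- ?B) x * ennreal (cmod (f x)) \<partial>lebesgue)"
      by (intro nn_integral_cong) (auto simp: indicator_def)
    also have "\<dots> = ?I ?B + ?I (- ?B)"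
      by (rule nn_integral_add) measurable
    finally have "(\<integral>\<^sup>+x. ennreal (cmod (f x)) \<partial>lebesgue)\<^sup>2 = (?I ?B + ?I (- ?B))\<^sup>2" by simp
    also have "\<dots> \<le> 2 * (?I ?B)\<^sup>2 + 2 * (?I (- ?B))\<^sup>2"
      by (rule ennreal_sum_power2_le)
    also have "\<dots> \<le> 2 * (ennreal (v * r powr N) * sq_integral f) + 2 * (ennreal (M * r powr (N - 2 * \<theta>)) * sq_integral (norm_weight \<theta> f))"
    proof (intro add_mono mult_left_mono)
      have "emeasure lebesgue ?B = ennreal (v * r powr N)"
        using r by (simp add: emeasure_cball v_def N_def powr_realpow)
      thus "(?I ?B)\<^sup>2 \<le> ennreal (v * r powr N) * sq_integral f"
        using Cauchy_Schwarz_on_set[OF fm, of ?B] by simp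
      have "(?I (- ?B))\<^sup>2 \<le> (\<integral>\<^sup>+x. indicator (- ?B) x * ennreal (norm x powr (- (2 * \<theta>))) \<partial>lebesgue) * sq_integral (norm_weight \<theta> f)"
        using B by (intro weighted_Cauchy_Schwarz fm) (simp add: Compl_in_sets_lebesgue)
      also have "\<dots> \<le> ennreal (M * r powr (N - 2 * \<theta>)) * sq_integral (norm_weight \<theta> f)"
        using nn_integral_norm_powr_outside[OF r, of "2 * \<theta>", where 'a="real^'n"] \<theta>
        by (intro mult_right_mono) (auto simp: M_def N_def v_def mult_ac)
      finally show "(?I (- ?B))\<^sup>2 \<le> ennreal (M * r powr (N - 2 * \<theta>)) * sq_integral (norm_weight \<theta> f)" .
    qed auto
    finally show ?thesis .
  qed
  show ?thesis
  proof (intro exI[of _ A] conjI ballI A0)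
    fix K :: "(real ^ 'n) set" and f :: "real ^ 'n \<Rightarrow> complex"
    assume K: "K \<in> sets lebesgue" and f: "f \<in> L2_space"
    have fm: "f \<in> borel_measurable lebesgue" and Sfin: "sq_integral f < top"
      using f by (auto simp: L2_space_iff)
    let ?L = "\<integral>\<^sup>+\<eta>\<in>K. ennreal ((cmod (mfrft \<alpha> lam f \<eta>))\<^sup>2) \<partial>lebesgue"
    let ?W = "sq_integral (norm_weight \<theta> f)"
    let ?R = "ennreal A * emeasure lebesgue K * epowr (L2_enorm f) (2 - real CARD('n) / \<theta>)
          * epowr (L2_enorm (norm_weight \<theta> f)) (real CARD('n) / \<theta>)"
    have enorm: "L2_enorm h = epowr (sq_integral h) (1 / 2)" for h :: "real ^ 'n \<Rightarrow> complex"
      by (simp add: L2_enorm_def sq_integral_def)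
    consider (S0) "sq_integral f = 0" | (null) "emeasure lebesgue K = 0"
      | (top) "sq_integral f \<noteq> 0" "emeasure lebesgue K \<noteq> 0" "?W = top"
      | (fin) "sq_integral f \<noteq> 0" "?W \<noteq> top"
      by blast
    thus "?L \<le> ?R"
    proof cases
      case S0
      have "?L \<le> ennreal (8 * C) * sq_integral (\<lambda>x. 0 - f x)"
        using mfrft_set_bound[OF f, of "\<lambda>_. 0" K] K by (simp add: L2_space_iff sq_integral_def[of "\<lambda>_. 0"])
      also have "\<dots> = 0"
        using S0 by (simp add: sq_integral_minus)
      finally show ?thesis by simp
    next
      case null
      hence "AE \<eta> in lebesgue. \<eta> \<notin> K"
        using K by (intro AE_not_in) auto
      hence "?L = (\<integral>\<^sup>+\<eta>. 0 \<partial>(lebesgue::(real^'n) measure))"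
        by (intro nn_integral_cong_AE) (auto elim!: eventually_mono)
      thus ?thesis by simp
    next
      case top
      obtain S where S: "sq_integral f = ennreal S" "S > 0"
        using top(1) Sfin by (cases "sq_integral f" rule: ennreal_cases) (auto simp: less_le)
      have "epowr (L2_enorm f) (2 - real CARD('n) / \<theta>) \<noteq> 0"
        using S by (simp add: enorm epowr_def)
      thus ?thesis
        using top A0 by (simp add: enorm[of "norm_weight \<theta> f"] epowr_def ennreal_mult_top)
    next
      case fin
      obtain S where S: "sq_integral f = ennreal S" "S > 0"
        using fin(1) Sfin by (cases "sq_integral f" rule: ennreal_cases) (auto simp: less_le)
      have "?W \<noteq> 0"
        using sq_integral_eq_0_if_weighted[OF fm] fin(1) by blast
      then obtain W where W: "?W = ennreal W" "W > 0"
        using fin(2) by (cases ?W rule: ennreal_cases) (auto simp: less_le)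
      define T where "T = S powr (1 - N / (2 * \<theta>)) * W powr (N / (2 * \<theta>))"
      have T0: "T > 0" using S W by (simp add: T_def)
      define r where "r = (W / S) powr (1 / (2 * \<theta>))"
      have r0: "r > 0" using S W by (simp add: r_def)
      have rS: "r powr N * S = T"
      proof -
        have "r powr N * S = W powr (N / (2 * \<theta>)) / S powr (N / (2 * \<theta>)) * S powr 1"
          using S W by (simp add: r_def powr_powr powr_divide)
        also have "\<dots> = T"
          using S by (simp add: T_def powr_diff)
        finally show ?thesis .
      qed
      have rW: "r powr (N - 2 * \<theta>) * W = T"
      proof -
        have "r powr (2 * \<theta>) = W / S"
          using S W \<theta>0 by (simp add: r_def powr_powr)
        thus ?thesis
          using rS S W by (simp add: powr_diff)
      qed
      have "(\<integral>\<^sup>+x. ennreal (cmod (f x)) \<partial>lebesgue)\<^sup>2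
          \<le> 2 * (ennreal (v * r powr N) * ennreal S) + 2 * (ennreal (M * r powr (N - 2 * \<theta>)) * ennreal W)"
        using L1[OF fm r0] unfolding S(1) W(1) .
      also have "\<dots> = ennreal (2 * (v + M) * T)"
      proof -
        have "ennreal (v * r powr N) * ennreal S = ennreal (v * T)"
          using v0 S(2) by (simp add: mult.assoc rS flip: ennreal_mult')
        moreover have "ennreal (M * r powr (N - 2 * \<theta>)) * ennreal W = ennreal (M * T)"
          using M0 W(2) by (simp add: mult.assoc rW flip: ennreal_mult')
        ultimately show ?thesis
          using v0 M0 T0 by (simp add: ennreal_mult' ennreal_plus distrib_left distrib_right mult.assoc)
      qed
      finally have L1f: "(\<integral>\<^sup>+x. ennreal (cmod (f x)) \<partial>lebesgue)\<^sup>2 \<le> ennreal (2 * (v + M) * T)" .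
      hence "(\<integral>\<^sup>+x. ennreal (cmod (f x)) \<partial>lebesgue)\<^sup>2 < top"
        using le_less_trans by fastforce
      hence "integrable lebesgue f"
        using fm by (intro integrableI_bounded) (auto simp: power_less_top_ennreal)
      hence "?L \<le> ennreal (2 * (kernel_bound \<alpha>)\<^sup>2) * emeasure lebesgue K * (\<integral>\<^sup>+x. ennreal (cmod (f x)) \<partial>lebesgue)\<^sup>2"
        using mfrft_set_bound[OF f _ f K] by (simp add: sq_integral_def[of "\<lambda>_. 0"])
      also have "\<dots> \<le> ennreal (2 * (kernel_bound \<alpha>)\<^sup>2) * emeasure lebesgue K * ennreal (2 * (v + M) * T)"
        by (intro mult_left_mono L1f) auto
      also have "\<dots> = emeasure lebesgue K * ennreal ((2 * (kernel_bound \<alpha>)\<^sup>2) * (2 * (v + M) * T))"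
        by (subst ennreal_mult'[of "2 * (kernel_bound \<alpha>)\<^sup>2"]) (simp_all only: mult_ac, simp)
      also have "\<dots> \<le> emeasure lebesgue K * ennreal (A * T)"
        using T0 by (intro mult_left_mono ennreal_leI) (auto simp: A_def algebra_simps)
      also have "\<dots> = ?R"
      proof -
        have "epowr (L2_enorm f) (2 - real CARD('n) / \<theta>) = ennreal (S powr (1 - N / (2 * \<theta>)))"
          using S \<theta>0 by (simp add: enorm epowr_def powr_powr N_def field_simps)
        moreover have "epowr (L2_enorm (norm_weight \<theta> f)) (real CARD('n) / \<theta>) = ennreal (W powr (N / (2 * \<theta>)))"
          using W by (simp add: enorm epowr_def powr_powr N_def mult_ac)
        ultimately show ?thesis
          using A0 by (simp add: T_def ennreal_mult' mult_ac)
      qed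
      finally show ?thesis .
    qed
  qed
qed

end

theorem mainTheorem11:
  fixes \<alpha> :: "real ^ 'n" and lam :: real
  assumes "lam \<noteq> 0"
    and "\<And>k. \<alpha> $ k \<in> {-pi<..<pi} - {0}"
  shows "(\<forall>\<theta>::real. 0 < \<theta> \<and> \<theta> < real CARD('n) / 2 \<longrightarrow>
           (\<exists>A::real. 0 \<le> A \<and> (\<forall>K \<in> sets lebesgue. \<forall>f \<in> L2_space.
              (\<integral>\<^sup>+\<eta>\<in>K. ennreal ((cmod (mfrft \<alpha> lam f \<eta>))\<^sup>2) \<partial>lebesgue)
              \<le> ennreal ((cmod (mfrft_C \<alpha>))\<^sup>2 * A * (abs_sin_prod \<alpha> / (lam\<^sup>2) ^ CARD('n)))
                 * epowr (emeasure lebesgue K) (2 * \<theta> / real CARD('n))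
                 * (L2_enorm (norm_weight \<theta> f))\<^sup>2)))
       \<and> (\<forall>\<theta>::real. real CARD('n) / 2 < \<theta> \<longrightarrow>
           (\<exists>A::real. 0 \<le> A \<and> (\<forall>K \<in> sets lebesgue. \<forall>f \<in> L2_space.
              (\<integral>\<^sup>+\<eta>\<in>K. ennreal ((cmod (mfrft \<alpha> lam f \<eta>))\<^sup>2) \<partial>lebesgue)
              \<le> ennreal ((cmod (mfrft_C \<alpha>))\<^sup>2 * A * (abs_sin_prod \<alpha> / (lam\<^sup>2) ^ CARD('n)))
                 * emeasure lebesgue K
                 * epowr (L2_enorm f) (2 - real CARD('n) / \<theta>)
                 * epowr (L2_enorm (norm_weight \<theta> f)) (real CARD('n) / \<theta>))))"
proof -
  have sin0: "sin (\<alpha> $ k) \<noteq> 0" for k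
  proof (cases "0 < \<alpha> $ k")
    case True
    thus ?thesis using assms(2)[of k] sin_gt_zero[of "\<alpha> $ k"] by auto
  next
    case False
    thus ?thesis using assms(2)[of k] sin_gt_zero[of "- \<alpha> $ k"] by auto
  qed
  have "mfrft_c t \<noteq> 0" for t
  proof -
    have "Re (1 - \<i> * complex_of_real (cot t)) = 1" by simp
    thus ?thesis unfolding mfrft_c_def by (metis csqrt_eq_0 zero_complex.sel(1) zero_neq_one)
  qed
  hence "cmod (mfrft_C \<alpha>) > 0"
    by (simp add: mfrft_C_def)
  \<comment> \<open>the factor of the constant prescribed by the statement; it is positive, so it can be divided out\<close>
  define D where "D = (cmod (mfrft_C \<alpha>))\<^sup>2 * (abs_sin_prod \<alpha> / (lam\<^sup>2) ^ CARD('n))"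
  have D0: "D > 0"
  proof -
    have "abs_sin_prod \<alpha> > 0" "(lam\<^sup>2) ^ CARD('n) > 0"
      using sin0 assms(1) by (simp_all add: abs_sin_prod_def)
    thus ?thesis
      using \<open>cmod (mfrft_C \<alpha>) > 0\<close> unfolding D_def by simp
  qed
  have DA: "(cmod (mfrft_C \<alpha>))\<^sup>2 * (A / D) * (abs_sin_prod \<alpha> / (lam\<^sup>2) ^ CARD('n)) = A" for A
  proof -
    have "(cmod (mfrft_C \<alpha>))\<^sup>2 * (A / D) * (abs_sin_prod \<alpha> / (lam\<^sup>2) ^ CARD('n)) = D * (A / D)"
      by (simp only: D_def mult_ac)
    thus ?thesis using D0 by simp
  qed
  obtain C where C: "0 \<le> C" "\<And>h. integrable lebesgue h \<Longrightarrow> sq_integral (mfrft_L1 \<alpha> lam h) \<le> ennreal C * sq_integral h"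
    by (rule mfrft_L1_square_integral_bound[OF assms(1) sin0], rule that)
  show ?thesis
  proof (intro conjI allI impI)
    fix \<theta> :: real assume \<theta>: "0 < \<theta> \<and> \<theta> < real CARD('n) / 2"
    obtain A where A: "0 < A" "\<forall>K\<in>sets lebesgue. \<forall>f\<in>L2_space.
     (\<integral>\<^sup>+\<eta>\<in>K. ennreal ((cmod (mfrft \<alpha> lam f \<eta>))\<^sup>2) \<partial>lebesgue)
      \<le> ennreal A * epowr (emeasure lebesgue K) (2 * \<theta> / real CARD('n)) * sq_integral (norm_weight \<theta> f)"
      using mfrft_local_uncertainty_small[OF C \<theta>[THEN conjunct1] \<theta>[THEN conjunct2]] by blast
    show "\<exists>A::real. 0 \<le> A \<and> (\<forall>K \<in> sets lebesgue. \<forall>f \<in> L2_space.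
              (\<integral>\<^sup>+\<eta>\<in>K. ennreal ((cmod (mfrft \<alpha> lam f \<eta>))\<^sup>2) \<partial>lebesgue)
              \<le> ennreal ((cmod (mfrft_C \<alpha>))\<^sup>2 * A * (abs_sin_prod \<alpha> / (lam\<^sup>2) ^ CARD('n)))
                 * epowr (emeasure lebesgue K) (2 * \<theta> / real CARD('n))
                 * (L2_enorm (norm_weight \<theta> f))\<^sup>2)"
      by (rule exI[of _ "A / D"]) (use A D0 in \<open>simp only: DA L2_enorm_power2, simp\<close>)
  next
    fix \<theta> :: real assume \<theta>: "real CARD('n) / 2 < \<theta>"
    obtain A where A: "0 < A" "\<forall>K\<in>sets lebesgue. \<forall>f\<in>L2_space.
     (\<integral>\<^sup>+\<eta>\<in>K. ennreal ((cmod (mfrft \<alpha> lam f \<eta>))\<^sup>2) \<partial>lebesgue)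
      \<le> ennreal A * emeasure lebesgue K * epowr (L2_enorm f) (2 - real CARD('n) / \<theta>)
          * epowr (L2_enorm (norm_weight \<theta> f)) (real CARD('n) / \<theta>)"
      using mfrft_local_uncertainty_large[OF C \<theta>] by blast
    show "\<exists>A::real. 0 \<le> A \<and> (\<forall>K \<in> sets lebesgue. \<forall>f \<in> L2_space.
              (\<integral>\<^sup>+\<eta>\<in>K. ennreal ((cmod (mfrft \<alpha> lam f \<eta>))\<^sup>2) \<partial>lebesgue)
              \<le> ennreal ((cmod (mfrft_C \<alpha>))\<^sup>2 * A * (abs_sin_prod \<alpha> / (lam\<^sup>2) ^ CARD('n)))
                 * emeasure lebesgue K
                 * epowr (L2_enorm f) (2 - real CARD('n) / \<theta>)
                 * epowr (L2_enorm (norm_weight \<theta> f)) (real CARD('n) / \<theta>))"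
      by (rule exI[of _ "A / D"]) (use A D0 in \<open>simp only: DA, simp\<close>)
  qed
qed

end
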